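(* Let $d>1$, $\mathcal{X}=\mathbb{S}_{d-1}(\sqrt d)$ the sphere of radius $\sqrt d$ in $\mathbb{R}^d$, $\mu$ the uniform distribution on $\mathcal{X}$, and let $\mathcal{G}$ act on $\mathcal{X}$ via an orthogonal representation $\phi$; set $\Phi=\int_\mathcal{G}\phi(g)\,d\lambda(g)$. Let $k(x,y)=x^\top y$ and let $f^\star(x)=\theta^\top x$ for some $\theta\in\mathbb{R}^d$ with $f^\star$ $\mathcal{G}$-invariant. Let the training sample $(X_i,Y_i)_{i=1}^n$ be i.i.d. with $X_i\sim\mu$, $Y_i=f^\star(X_i)+\xi_i$, $\mathbb{E}[\xi_i\mid X_1,\dots,X_n]=0$, $\mathbb{E}[\xi_i\xi_j\mid X_1,\dots,X_n]=\delta_{ij}$; let $X\sim\mu$, $Y=f^\star(X)+\xi$, $\mathbb{E}[\xi\mid X]=0$, $\mathbb{E}[\xi^2]=1$. For $\rho>0$ let $f(x)=k_{\mathbf{X}}(x)^\top(K+\rho I)^{-1}\mathbf{Y}$ be the kernel ridge regression solution, $K_{ij}=k(X_i,X_j)$, with eigenvalues $\gamma_1,\dots,\gamma_n$ of $K$, and let $f'$ be any predictor with $R[f']\le R[\mathcal{O}f]$. Define $\zeta_1(\rho)=\mathbb{E}\big[\sum_{i=1}^n\frac{\gamma_i^2}{(\gamma_i+\rho)^2}\big]$ and $\zeta_2(\rho)=\mathbb{E}\big[\big(\sum_{i=1}^n\frac{\gamma_i}{\gamma_i+\rho}\big)^2\big]$. Then \[\mathbb{E}[R[f]-R[f']]\ge\frac{\|\theta\|_2^2(d\zeta_1(\rho)-\zeta_2(\rho))(d-\|\Phi\|_F^2)}{d(d+2)(d-1)}+\frac{d-\|\Phi\|_F^2}{(d\sqrt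 n+\rho/\sqrt n)^2},\] where each term is non-negative, the first term equals $\mathbb{E}[\|(\mathrm{id}-\mathcal{O})\Lambda_{n,\rho}f^\star\|_\mu^2]$ and the second equals $\|k^\perp\|^2_{L_2(\mu\otimes\mu)}/(\sqrt nM_k+\rho/\sqrt n)^2$ with $M_k=\sup_xk(x,x)=d$.
   Context: $\mathcal{G}$ is a compact, second countable, Hausdorff topological group with Haar probability measure $\lambda$; $\phi$ is a measurable orthogonal representation. $\mathcal{O}h(x)=\int_\mathcal{G}h(\phi(g)x)d\lambda(g)$; $\|\cdot\|_\mu$ is the $L_2(\mu)$ norm; $\|\cdot\|_F$ the Frobenius norm. $k_{\mathbf{X}}(x)_i=k(X_i,x)$, $\mathbf{Y}_i=Y_i$. $\Lambda_{n,\rho}f^\star$ is the minimiser over the RKHS $\mathcal{H}$ of $k$ of $\sum_{i=1}^n(h(X_i)-f^\star(X_i))^2+\rho\|h\|_\mathcal{H}^2$. $k^\perp(x,y)=k(x,y)-\int_\mathcal{G}k(x,\phi(g)y)d\lambda(g)$, $\|j\|^2_{L_2(\mu\otimes\mu)}=\iint j(x,y)^2d\mu(x)d\mu(y)$. The risk is $R[h]=\mathbb{E}[(h(X)-Y)^2]$ conditional on the training sample; the outer expectation is over the training sample. *)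

theory Defs
  imports "HOL-Probability.Probability"
begin

definition haar_compact_group ::
  "('g::{t2_space,second_countable_topology} \<Rightarrow> 'g \<Rightarrow> 'g) \<Rightarrow> 'g \<Rightarrow> ('g \<Rightarrow> 'g) \<Rightarrow> 'g measure \<Rightarrow> bool" where
  "haar_compact_group gmul e ginv lam \<longleftrightarrow>
     (\<forall>a b c. gmul (gmul a b) c = gmul a (gmul b c)) \<and>
     (\<forall>a. gmul e a = a \<and> gmul a e = a) \<and>
     (\<forall>a. gmul (ginv a) a = e \<and> gmul a (ginv a) = e) \<and>
     compact (UNIV :: 'g set) \<and>
     continuous_on UNIV (\<lambda>p. gmul (fst p) (snd p)) \<and>
     continuous_on UNIV ginv \<and>
     prob_space lam \<and> sets lam = sets borel \<and>
     (\<forall>a A. A \<in> sets lam \<longrightarrow> emeasure lam ((\<lambda>b. gmul a b) -` A) = emeasure lam A)"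

definition orth_rep ::
  "('g \<Rightarrow> 'g \<Rightarrow> 'g) \<Rightarrow> 'g measure \<Rightarrow> ('g \<Rightarrow> real^'n^'n) \<Rightarrow> bool" where
  "orth_rep gmul lam \<phi> \<longleftrightarrow>
     (\<forall>a b. \<phi> (gmul a b) = \<phi> a ** \<phi> b) \<and>
     (\<forall>a. orthogonal_matrix (\<phi> a)) \<and>
     \<phi> \<in> borel_measurable lam"

text \<open>Uniform distribution on the sphere of radius r: the (unique) probability measure
 on the sphere invariant under all orthogonal transformations.\<close>
definition uniform_sphere :: "real \<Rightarrow> (real^'n) measure \<Rightarrow> bool" where
  "uniform_sphere r \<mu> \<longleftrightarrow>
     prob_space \<mu> \<and> sets \<mu> = sets borel \<and> emeasure \<mu> (sphere 0 r) = 1 \<and>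
     (\<forall>Q::real^'n^'n. orthogonal_matrix Q \<longrightarrow> distr \<mu> borel (\<lambda>x. Q *v x) = \<mu>)"

definition orbit_avg :: "'g measure \<Rightarrow> ('g \<Rightarrow> real^'n^'n) \<Rightarrow> (real^'n \<Rightarrow> real) \<Rightarrow> real^'n \<Rightarrow> real" where
  "orbit_avg lam \<phi> h x = (\<integral>g. h (\<phi> g *v x) \<partial>lam)"

definition frobenius_norm :: "real^'n^'m \<Rightarrow> real" where
  "frobenius_norm A = sqrt (\<Sum>i\<in>UNIV. \<Sum>j\<in>UNIV. (A $ i $ j)^2)"

definition lin_kernel :: "real^'n \<Rightarrow> real^'n \<Rightarrow> real" where
  "lin_kernel x y = x \<bullet> y"

definition krr :: "('m::finite \<Rightarrow> real^'n) \<Rightarrow> ('m \<Rightarrow> real) \<Rightarrow> real \<Rightarrow> real^'n \<Rightarrow> real" where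
  "krr X Y \<rho> x =
     (\<chi> i. lin_kernel (X i) x) \<bullet>
       (matrix_inv ((\<chi> i j. lin_kernel (X i) (X j)) + \<rho> *\<^sub>R mat 1) *v (\<chi> i. Y i))"

text \<open>gamma lists the eigenvalues of A with algebraic multiplicity:
 the characteristic polynomial det(t I - A) factors as prod_i (t - gamma_i).\<close>
definition eigenvalues_mult :: "real^'m::finite^'m \<Rightarrow> ('m \<Rightarrow> real) \<Rightarrow> bool" where
  "eigenvalues_mult A \<gamma> \<longleftrightarrow> (\<forall>t. det (t *\<^sub>R mat 1 - A) = (\<Prod>i\<in>UNIV. t - \<gamma> i))"

text \<open>Lambda_{n,rho} g: minimiser over the RKHS of the linear kernel (functions
 x |-> w . x with RKHS norm |w|) of sum_i (h(X_i) - g(X_i))^2 + rho |h|_H^2.\<close>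
definition ridge_objective :: "('m::finite \<Rightarrow> real^'n) \<Rightarrow> real \<Rightarrow> (real^'n \<Rightarrow> real) \<Rightarrow> real^'n \<Rightarrow> real" where
  "ridge_objective X \<rho> g w = (\<Sum>i\<in>UNIV. (w \<bullet> X i - g (X i))^2) + \<rho> * (norm w)^2"

definition Lambda_ridge :: "('m::finite \<Rightarrow> real^'n) \<Rightarrow> real \<Rightarrow> (real^'n \<Rightarrow> real) \<Rightarrow> real^'n \<Rightarrow> real" where
  "Lambda_ridge X \<rho> g = (\<lambda>x. (THE w. \<forall>v. ridge_objective X \<rho> g w \<le> ridge_objective X \<rho> g v) \<bullet> x)"

definition kperp :: "'g measure \<Rightarrow> ('g \<Rightarrow> real^'n^'n) \<Rightarrow> real^'n \<Rightarrow> real^'n \<Rightarrow> real" where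
  "kperp lam \<phi> x y = lin_kernel x y - (\<integral>g. lin_kernel x (\<phi> g *v y) \<partial>lam)"

definition risk :: "'v measure \<Rightarrow> ('v \<Rightarrow> real^'n) \<Rightarrow> ('v \<Rightarrow> real) \<Rightarrow> (real^'n \<Rightarrow> real) \<Rightarrow> real" where
  "risk N Xt Yt h = (\<integral>v. (h (Xt v) - Yt v)^2 \<partial>N)"

end

theory Submission
  imports Defs "HOL-Computational_Algebra.Polynomial"
begin

text \<open>
  Write \<open>A = X\<^sup>T (K + \<rho>)\<^sup>-\<^sup>1 X\<close>, where \<open>X\<close> is the matrix with rows \<open>X\<^sub>i\<close> and \<open>K = X X\<^sup>T\<close>. Then
  \<open>\<Lambda> f\<^sup>\<star>\<close> is the linear function with weight \<open>A \<theta>\<close>, and the ridge solution has weight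
  \<open>w = A \<theta> + X\<^sup>T (K + \<rho>)\<^sup>-\<^sup>1 \<xi>\<close>. Since \<open>\<Phi>\<close> is an orthogonal projection fixing \<open>\<theta>\<close>, Pythagoras
  gives \<open>R[f] - R[O f] = |P w|\<^sup>2\<close> with \<open>P = 1 - \<Phi>\<close>, and the conditional moments of the noise split
  the expectation into \<open>E |P A \<theta>|\<^sup>2\<close> and the expected square of the Frobenius norm of
  \<open>P X\<^sup>T (K + \<rho>)\<^sup>-\<^sup>1\<close>. The latter is bounded below through \<open>|(K + \<rho>) y| \<le> (n d + \<rho>) |y|\<close>.
  For the former, the law of \<open>A\<close> is invariant under orthogonal conjugation, so
  \<open>E (u \<bullet> A v)\<^sup>2 = \<beta> |u|\<^sup>2 |v|\<^sup>2\<close> whenever \<open>u \<bullet> v = 0\<close>; applying this to the rows of \<open>P\<close>, which are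
  orthogonal to \<open>\<theta>\<close>, gives \<open>\<beta> |\<theta>|\<^sup>2\<close> times the squared Frobenius norm of \<open>P\<close>. The constant \<open>\<beta>\<close> is
  read off from \<open>d tr A\<^sup>2 - (tr A)\<^sup>2\<close>, whose expectation is \<open>d (d + 2) (d - 1) \<beta>\<close>.
\<close>

section \<open>Symmetric and orthogonal matrices\<close>

lemma inner_matrix_vector_mult:
  fixes A :: "real^'n^'m"
  shows "x \<bullet> (A *v y) = (transpose A *v x) \<bullet> y"
  by (simp add: dot_lmul_matrix)

lemma inner_orthogonal_matrix_mult:
  fixes Q :: "real^'n^'n"
  assumes "orthogonal_matrix Q"
  shows "(Q *v x) \<bullet> (Q *v y) = x \<bullet> y"
  using assms orthogonal_transformation_matrix[of "(*v) Q"] by (simp add: orthogonal_transformation_def)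

lemma
  fixes A :: "real^'n^'n"
  assumes "det A \<noteq> 0"
  shows matrix_mult_matrix_inv: "A ** matrix_inv A = mat 1"
    and matrix_inv_mult_matrix: "matrix_inv A ** A = mat 1"
proof -
  have "\<exists>B. A ** B = mat 1 \<and> B ** A = mat 1"
    using assms by (simp add: invertible_det_nz[symmetric] invertible_def)
  then have "A ** matrix_inv A = mat 1 \<and> matrix_inv A ** A = mat 1"
    unfolding matrix_inv_def by (rule someI_ex)
  then show "A ** matrix_inv A = mat 1" "matrix_inv A ** A = mat 1" by blast+
qed

section \<open>The spectral theorem for real symmetric matrices\<close>

text \<open>A maximiser of the Rayleigh quotient on the unit sphere of the subspace is an eigenvector.\<close>

lemma symmetric_matrix_eigenvector_in_subspace:
  fixes A :: "real^'n^'n"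
  assumes sym: "transpose A = A" and S: "subspace S" and inv: "\<And>x. x \<in> S \<Longrightarrow> A *v x \<in> S"
    and ne: "x0 \<in> S" "x0 \<noteq> 0"
  obtains v c where "v \<in> S" "norm v = 1" "A *v v = c *\<^sub>R v"
proof -
  have adj: "x \<bullet> (A *v y) = (A *v x) \<bullet> y" for x y
    using inner_matrix_vector_mult[of x A y] sym by simp
  let ?T = "S \<inter> sphere 0 1"
  have "closed S" using S by (rule closed_subspace)
  then have "compact ?T" by (rule closed_Int_compact) simp
  moreover have "?T \<noteq> {}"
  proof -
    have "x0 /\<^sub>R norm x0 \<in> ?T" using ne S by (simp add: subspace_scale)
    then show ?thesis by blast
  qed
  moreover have "continuous_on ?T (\<lambda>x. x \<bullet> (A *v x))"
    by (intro continuous_intros)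
  ultimately have "\<exists>v\<in>?T. \<forall>y\<in>?T. y \<bullet> (A *v y) \<le> v \<bullet> (A *v v)"
    by (rule continuous_attains_sup)
  then obtain v where v: "v \<in> ?T" and max: "\<And>y. y \<in> ?T \<Longrightarrow> y \<bullet> (A *v y) \<le> v \<bullet> (A *v v)"
    by blast
  define c where "c = v \<bullet> (A *v v)"
  \<comment> \<open>By homogeneity, maximality of \<open>v\<close> makes this quadratic form
    nonnegative on \<open>S\<close>, and it vanishes at \<open>v\<close>. Its first variation at
    \<open>v\<close> along the residual \<open>w\<close> must then vanish, which forces
    \<open>w = 0\<close>.\<close>
  define q where "q x = c * (x \<bullet> x) - x \<bullet> (A *v x)" for x
  have q_nonneg: "q y \<ge> 0" if "y \<in> S" for y
  proof (cases "y = 0")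
    case False
    let ?y = "y /\<^sub>R norm y"
    have "?y \<bullet> (A *v ?y) \<le> c"
      unfolding c_def using that False S by (intro max) (auto simp: subspace_scale)
    moreover have "?y \<bullet> (A *v ?y) = (y \<bullet> (A *v y)) / (y \<bullet> y)"
      by (simp add: matrix_vector_mult_scaleR power2_norm_eq_inner[symmetric] power2_eq_square divide_simps)
    ultimately show ?thesis using False
      by (simp add: q_def divide_le_eq mult.commute)
  qed (simp add: q_def)
  define w where "w = A *v v - c *\<^sub>R v"
  have w: "w \<in> S" using v inv S by (simp add: w_def subspace_diff subspace_scale)
  have vv: "v \<bullet> v = 1" using v by (simp add: norm_eq_1)
  have expand: "q (v + t *\<^sub>R w) = t\<^sup>2 * q w - 2 * t * (w \<bullet> w)" for t
  proof -
    have 1: "v \<bullet> (A *v w) = w \<bullet> (A *v v)"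
      using adj[of v w] by (simp add: inner_commute)
    have 2: "w \<bullet> (A *v v) = w \<bullet> w + c * (v \<bullet> w)"
      by (simp add: w_def algebra_simps inner_diff inner_commute)
    have "q (v + t *\<^sub>R w) = q v + t\<^sup>2 * q w + 2 * t * (c * (v \<bullet> w) - w \<bullet> (A *v v))"
      by (simp add: q_def matrix_vector_right_distrib matrix_vector_mult_scaleR inner_add 1
          inner_commute[of w v] power2_eq_square algebra_simps)
    moreover have "q v = 0" by (simp add: q_def c_def vv)
    ultimately show ?thesis by (simp add: 2)
  qed
  have "w \<bullet> w = 0"
  proof (rule ccontr)
    assume "w \<bullet> w \<noteq> 0"
    then have pos: "w \<bullet> w > 0" by simp
    \<comment> \<open>With this step size \<open>t * q w\<close> stays below
      \<open>w \<bullet> w\<close>, although nonnegativity of \<open>q\<close> at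
      \<open>v + t *\<^sub>R w\<close> demands at least twice that. The 1 keeps the denominator
      positive when \<open>q w = 0\<close>.\<close>
    define t where "t = (w \<bullet> w) / (q w + 1)"
    have qw: "q w \<ge> 0" using w by (rule q_nonneg)
    have t: "t > 0" using pos qw by (simp add: t_def)
    have "v + t *\<^sub>R w \<in> S" using v w S by (simp add: subspace_add subspace_scale)
    then have "t * (t * q w) \<ge> t * (2 * (w \<bullet> w))"
      using q_nonneg expand[of t] by (fastforce simp: power2_eq_square)
    then have "t * q w \<ge> 2 * (w \<bullet> w)" using t by simp
    moreover have "t * (q w + 1) = w \<bullet> w" using qw by (simp add: t_def)
    ultimately show False using t pos by (simp add: algebra_simps)
  qed
  then have "A *v v = c *\<^sub>R v" by (simp add: w_def)
  with v show ?thesis by (intro that[of v c]) auto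
qed

text \<open>Indexing by the dimension type itself makes such a family a basis and lets its vectors
  serve as the rows of a square matrix.\<close>

definition orthonormal_family :: "('n \<Rightarrow> real^'n) \<Rightarrow> bool" where
  "orthonormal_family b \<longleftrightarrow> (\<forall>i j. b i \<bullet> b j = (if i = j then 1 else 0))"

text \<open>Take an orthonormal set of eigenvectors of largest cardinality. By symmetry its
  orthogonal complement is invariant under \<open>A\<close>, so a nonzero vector there would yield
  one more eigenvector; hence the complement is zero and the set spans.\<close>

theorem symmetric_matrix_orthonormal_eigenvectors:
  fixes A :: "real^'n^'n"
  assumes sym: "transpose A = A"
  obtains b D where "orthonormal_family b" "\<And>i. A *v b i = D i *\<^sub>R b i"
proof -
  define Q where "Q B \<longleftrightarrow> pairwise orthogonal B \<and> (\<forall>x\<in>B. norm x = 1 \<and> (\<exists>c. A *v x = c *\<^sub>R x))"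
    for B :: "(real^'n) set"
  have bound: "finite B \<and> card B \<le> CARD('n)" if "Q B" for B
  proof -
    have "0 \<notin> B" using that by (auto simp: Q_def)
    then have "independent B" using that pairwise_orthogonal_independent[of B] by (simp add: Q_def)
    then show ?thesis using independent_bound[of B] by simp
  qed
  have "Q {}" by (simp add: Q_def)
  then obtain B where B: "Q B" and max: "\<And>C. Q C \<Longrightarrow> card C \<le> card B"
    using ex_has_greatest_nat[of Q "{}" card "Suc CARD('n)"] bound by (metis le_imp_less_Suc)
  define S where "S = {y. \<forall>x\<in>B. orthogonal x y}"
  have S0: "x = 0" if x: "x \<in> S" for x
  proof (rule ccontr)
    assume "x \<noteq> 0"
    have inv: "A *v y \<in> S" if "y \<in> S" for y
    proof -
      have "x \<bullet> (A *v y) = 0" if "x \<in> B" for x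
      proof -
        obtain c where "A *v x = c *\<^sub>R x" using B \<open>x \<in> B\<close> by (auto simp: Q_def)
        moreover have "x \<bullet> y = 0" using \<open>y \<in> S\<close> \<open>x \<in> B\<close> by (auto simp: S_def orthogonal_def)
        ultimately show ?thesis
          using inner_matrix_vector_mult[of x A y] sym by simp
      qed
      then show ?thesis by (simp add: S_def orthogonal_def)
    qed
    obtain v c where v: "v \<in> S" "norm v = 1" "A *v v = c *\<^sub>R v"
      using symmetric_matrix_eigenvector_in_subspace[OF sym _ inv x \<open>x \<noteq> 0\<close>]
      by (auto simp: S_def subspace_orthogonal_to_vectors)
    have "v \<notin> B"
      using v by (auto simp: S_def orthogonal_def norm_eq_1)
    have "Q (insert v B)"
      using B v by (auto simp: Q_def S_def pairwise_insert orthogonal_commute)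
    from max[OF this] show False
      using \<open>v \<notin> B\<close> bound[OF B] by simp
  qed
  have "span B = UNIV"
  proof (rule ccontr)
    assume "span B \<noteq> UNIV"
    then obtain x where "x \<noteq> 0" "\<And>y. y \<in> span B \<Longrightarrow> orthogonal x y"
      using orthogonal_to_subspace_exists_gen[of B UNIV] by auto
    then have "x \<in> S" by (auto simp: S_def orthogonal_commute span_base)
    with S0 \<open>x \<noteq> 0\<close> show False by blast
  qed
  moreover have "independent B"
    using B pairwise_orthogonal_independent[of B] by (force simp: Q_def)
  ultimately have "card B = CARD('n)"
    using dim_eq_card[of B UNIV] by simp
  then obtain b where b: "bij_betw b (UNIV::'n set) B"
    using bound[OF B] by (metis finite_class.finite_UNIV finite_same_card_bij)
  have mem: "b i \<in> B" for i using b by (auto simp: bij_betw_def)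
  have "orthonormal_family b"
    unfolding orthonormal_family_def
  proof (intro allI)
    fix i j
    show "b i \<bullet> b j = (if i = j then 1 else 0)"
    proof (cases "i = j")
      case True
      then show ?thesis using B mem[of j] by (simp add: Q_def norm_eq_1)
    next
      case False
      then have "b i \<noteq> b j" using b by (auto simp: bij_betw_def inj_on_def)
      then show ?thesis using B mem[of i] mem[of j] False by (auto simp: Q_def pairwise_def orthogonal_def)
    qed
  qed
  moreover have "\<forall>i. \<exists>c. A *v b i = c *\<^sub>R b i" using B mem by (auto simp: Q_def)
  ultimately show ?thesis using that by metis
qed

section \<open>Trace, determinant and norm in an orthonormal basis\<close>

lemma orthonormal_family_orthogonal_matrix:
  assumes "orthonormal_family b"
  shows "orthogonal_matrix (\<chi> i. b i)"
  using assms unfolding orthonormal_family_def orthogonal_matrix_orthonormal_rows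
  by (auto simp: row_def norm_eq_1 orthogonal_def)

text \<open>Serves to read trace and determinant of \<open>N\<close> off its form in the basis
  \<open>b\<close>, both being unchanged by orthogonal conjugation.\<close>

lemma matrix_conjugate_rows_component:
  fixes N :: "real^'n^'n"
  shows "((\<chi> i. b i) ** N ** transpose (\<chi> i. b i)) $ i $ j = b i \<bullet> (N *v b j)"
proof -
  have "b i \<bullet> (N *v b j) = (\<Sum>k\<in>UNIV. \<Sum>l\<in>UNIV. b i $ k * (N $ k $ l * b j $ l))"
    by (simp add: inner_vec_def matrix_vector_mult_def sum_distrib_left)
  also have "\<dots> = (\<Sum>l\<in>UNIV. \<Sum>k\<in>UNIV. b i $ k * (N $ k $ l * b j $ l))"
    by (rule sum.swap)
  also have "\<dots> = ((\<chi> i. b i) ** N ** transpose (\<chi> i. b i)) $ i $ j"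
    by (simp add: matrix_matrix_mult_def transpose_def sum_distrib_right mult.assoc)
  finally show ?thesis by simp
qed

lemma trace_orthonormal_family:
  fixes N :: "real^'n^'n"
  assumes b: "orthonormal_family b"
  shows "trace N = (\<Sum>i\<in>UNIV. b i \<bullet> (N *v b i))"
proof -
  let ?V = "(\<chi> i. b i) :: real^'n^'n"
  have "trace (?V ** N ** transpose ?V) = trace (transpose ?V ** ?V ** N)"
    by (metis trace_mul_sym matrix_mul_assoc)
  also have "\<dots> = trace N"
    using orthonormal_family_orthogonal_matrix[OF b] by (simp add: orthogonal_matrix_def)
  finally show ?thesis by (simp add: trace_def matrix_conjugate_rows_component)
qed

lemma det_orthonormal_eigenvectors:
  fixes N :: "real^'n^'n"
  assumes b: "orthonormal_family b" and ev: "\<And>i. N *v b i = D i *\<^sub>R b i"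
  shows "det N = (\<Prod>i\<in>UNIV. D i)"
proof -
  let ?V = "(\<chi> i. b i) :: real^'n^'n"
  have "?V ** transpose ?V = mat 1"
    using orthonormal_family_orthogonal_matrix[OF b] by (simp add: orthogonal_matrix_def)
  then have "det ?V * det (transpose ?V) = 1" by (metis det_I det_mul)
  then have "det N = det (?V ** N ** transpose ?V)" by (simp add: det_mul mult_ac)
  also have "\<dots> = (\<Prod>i\<in>UNIV. (?V ** N ** transpose ?V) $ i $ i)"
    using b by (intro det_diagonal)
      (simp add: matrix_conjugate_rows_component ev orthonormal_family_def)
  also have "\<dots> = (\<Prod>i\<in>UNIV. D i)"
    using b by (simp add: matrix_conjugate_rows_component ev orthonormal_family_def)
  finally show ?thesis .
qed

lemma parseval_orthonormal_family:
  fixes w :: "real^'n"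
  assumes b: "orthonormal_family b"
  shows "(norm w)\<^sup>2 = (\<Sum>i\<in>UNIV. (b i \<bullet> w)\<^sup>2)"
proof -
  let ?V = "(\<chi> i. b i) :: real^'n^'n"
  have "orthogonal_transformation ((*v) ?V)"
    using orthonormal_family_orthogonal_matrix[OF b] by (simp add: orthogonal_transformation_matrix)
  then have "norm (?V *v w) = norm w" by (simp add: orthogonal_transformation)
  moreover have "(norm (?V *v w))\<^sup>2 = (\<Sum>i\<in>UNIV. (b i \<bullet> w)\<^sup>2)"
    unfolding power2_norm_eq_inner inner_vec_def[of "?V *v w"]
    by (simp add: matrix_vector_mul_component power2_eq_square)
  ultimately show ?thesis by simp
qed

section \<open>Sums over eigenvalues listed with multiplicity\<close>

lemma sum_eq_of_prod_linear_eq: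
  fixes \<gamma> \<delta> :: "'m::finite \<Rightarrow> real" and h :: "real \<Rightarrow> 'b::comm_monoid_add"
  assumes "\<And>t. (\<Prod>i\<in>UNIV. t - \<gamma> i) = (\<Prod>i\<in>UNIV. t - \<delta> i)"
  shows "(\<Sum>i\<in>UNIV. h (\<gamma> i)) = (\<Sum>i\<in>UNIV. h (\<delta> i))"
proof -
  define p where "p \<gamma> = (\<Prod>i\<in>UNIV. [:- \<gamma> i, 1:])" for \<gamma> :: "'m \<Rightarrow> real"
  \<comment> \<open>Over the reals a polynomial is determined by its values, and a product of monic
    linear factors by its multiset of roots. So both families have the same image multiset.\<close>
  have "poly (p \<gamma>) = poly (p \<delta>)"
    using assms by (auto simp: p_def poly_prod)
  then have "proots (p \<gamma>) = proots (p \<delta>)" by (simp add: poly_eq_poly_eq_iff)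
  moreover have "proots (p \<gamma>) = image_mset \<gamma> (mset_set UNIV)" for \<gamma>
  proof -
    have "proots (p \<gamma>) = (\<Sum>i\<in>UNIV. {#\<gamma> i#})"
      unfolding p_def by (subst proots_prod) auto
    also have "\<dots> = image_mset \<gamma> (mset_set UNIV)"
      by (simp add: sum_unfold_sum_mset)
    finally show ?thesis .
  qed
  ultimately have "image_mset h (image_mset \<gamma> (mset_set UNIV)) = image_mset h (image_mset \<delta> (mset_set UNIV))"
    by simp
  then have "sum_mset (image_mset (\<lambda>i. h (\<gamma> i)) (mset_set UNIV)) = sum_mset (image_mset (\<lambda>i. h (\<delta> i)) (mset_set UNIV))"
    by (simp add: image_mset.compositionality o_def)
  then show ?thesis by (simp add: sum_unfold_sum_mset)
qed

text \<open>The characteristic polynomial fixes \<open>\<gamma>\<close> only up to order, so a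
  spectral sum may be computed from any orthonormal eigenbasis instead.\<close>

lemma sum_eigenvalues_mult:
  fixes A :: "real^'m::finite^'m" and h :: "real \<Rightarrow> 'b::comm_monoid_add"
  assumes "eigenvalues_mult A \<gamma>" and b: "orthonormal_family b" and ev: "\<And>i. A *v b i = D i *\<^sub>R b i"
  shows "(\<Sum>i\<in>UNIV. h (\<gamma> i)) = (\<Sum>i\<in>UNIV. h (D i))"
proof (rule sum_eq_of_prod_linear_eq)
  fix t
  have "(t *\<^sub>R mat 1 - A) *v b i = (t - D i) *\<^sub>R b i" for i
    by (simp add: matrix_vector_mult_diff_rdistrib scaleR_matrix_vector_assoc[symmetric] ev algebra_simps)
  from det_orthonormal_eigenvectors[OF b this] assms(1)
  show "(\<Prod>i\<in>UNIV. t - \<gamma> i) = (\<Prod>i\<in>UNIV. t - D i)"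
    by (simp add: eigenvalues_mult_def)
qed

section \<open>Reflections and transitivity of the orthogonal group on orthonormal pairs\<close>

lemma householder_reflection:
  fixes a b :: "real^'n"
  assumes "norm a = norm b"
  obtains Q where "orthogonal_matrix Q" "Q *v a = b" "\<And>x. x \<bullet> (a - b) = 0 \<Longrightarrow> Q *v x = x"
proof -
  define c where "c = a - b"
  \<comment> \<open>Reflection in the hyperplane orthogonal to \<open>a - b\<close>. If
    \<open>a = b\<close>, the subtracted multiple of \<open>c\<close> is zero and \<open>H\<close>
    is the identity.\<close>
  define H where "H x = x - (2 * (c \<bullet> x) / (c \<bullet> c)) *\<^sub>R c" for x
  have lin: "linear H"
    by (rule linearI) (simp_all add: H_def inner_add algebra_simps add_divide_distrib)
  have "norm (H x) = norm x" for x
  proof -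
    have "H x \<bullet> H x = x \<bullet> x"
      by (cases "c = 0")
        (simp_all add: H_def inner_diff inner_commute algebra_simps power2_eq_square divide_simps)
    then show ?thesis by (simp add: norm_eq)
  qed
  with lin have "orthogonal_transformation H" by (simp add: orthogonal_transformation)
  then have "orthogonal_matrix (matrix H)" by (simp add: orthogonal_transformation_matrix)
  moreover have "matrix H *v x = H x" for x
    using lin by (simp add: matrix_works linear_matrix_vector_mul_eq)
  moreover have "H a = b"
  proof (cases "c = 0")
    case False
    have "a \<bullet> a = b \<bullet> b" using assms by (simp add: norm_eq)
    then have "c \<bullet> c = 2 * (c \<bullet> a)"
      by (simp add: c_def inner_diff inner_commute)
    moreover have "c \<bullet> c \<noteq> 0" using False by simp
    ultimately have "2 * (c \<bullet> a) / (c \<bullet> c) = 1" by simp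
    then have "H a = a - c" unfolding H_def by (simp only: scaleR_one)
    then show ?thesis by (simp add: c_def)
  qed (simp add: H_def c_def)
  moreover have "H x = x" if "x \<bullet> (a - b) = 0" for x
    using that by (simp add: H_def c_def inner_commute)
  ultimately show ?thesis by (intro that[of "matrix H"]) simp_all
qed

text \<open>Two reflections suffice. The first takes \<open>u\<close> to \<open>u'\<close>; the
  second takes the image of \<open>v\<close> to \<open>v'\<close> and fixes \<open>u'\<close>,
  because \<open>u'\<close> is orthogonal to both of these vectors.\<close>

lemma orthogonal_matrix_maps_orthonormal_pair:
  fixes u v u' v' :: "real^'n"
  assumes "norm u = 1" "norm v = 1" "u \<bullet> v = 0" "norm u' = 1" "norm v' = 1" "u' \<bullet> v' = 0"
  obtains Q where "orthogonal_matrix Q" "Q *v u = u'" "Q *v v = v'"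
proof -
  obtain Q1 where Q1: "orthogonal_matrix Q1" "Q1 *v u = u'"
    using householder_reflection[of u u'] assms by metis
  then have "(Q1 *v x) \<bullet> (Q1 *v y) = x \<bullet> y" for x y
    by (simp add: inner_orthogonal_matrix_mult)
  then have "norm (Q1 *v v) = norm v'" and "u' \<bullet> (Q1 *v v) = 0"
    using assms unfolding Q1(2)[symmetric] by (simp_all add: norm_eq_sqrt_inner)
  then obtain Q2 where Q2: "orthogonal_matrix Q2" "Q2 *v (Q1 *v v) = v'" "Q2 *v u' = u'"
    using householder_reflection[of "Q1 *v v" v'] assms by (metis inner_diff_right diff_self)
  show ?thesis
    using Q1 Q2 by (intro that[of "Q2 ** Q1"])
      (simp_all add: orthogonal_matrix_mul matrix_vector_mul_assoc[symmetric])
qed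

section \<open>Ridge regression with the linear kernel\<close>

definition design :: "('m::finite \<Rightarrow> real^'n) \<Rightarrow> real^'n^'m" where
  "design X = (\<chi> i. X i)"

definition gram :: "('m::finite \<Rightarrow> real^'n) \<Rightarrow> real^'m^'m" where
  "gram X = (\<chi> i j. X i \<bullet> X j)"

definition resolvent :: "('m::finite \<Rightarrow> real^'n) \<Rightarrow> real \<Rightarrow> real^'m^'m" where
  "resolvent X \<rho> = matrix_inv (gram X + \<rho> *\<^sub>R mat 1)"

text \<open>For \<rho> > 0 this is the shrinkage matrix \<open>(S + \<rho>)^-1 S\<close> with
  \<open>S = X^T X\<close>, sending the true weight to the noiseless ridge weight. Writing it
  through the resolvent of the Gram matrix connects it to the eigenvalues \<gamma>.\<close>

definition ridge_op :: "('m::finite \<Rightarrow> real^'n) \<Rightarrow> real \<Rightarrow> real^'n^'n" where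
  "ridge_op X \<rho> = transpose (design X) ** resolvent X \<rho> ** design X"

lemma gram_eq_design: "gram X = design X ** transpose (design X)"
  by (simp add: gram_def design_def vec_eq_iff matrix_matrix_mult_def transpose_def inner_vec_def)

lemma transpose_gram [simp]: "transpose (gram X) = gram X"
  by (simp add: gram_def transpose_def inner_commute)

lemma design_mult_component [simp]: "(design X *v x) $ i = X i \<bullet> x"
  by (simp add: design_def matrix_vector_mul_component)

lemma norm_design_mult: "(norm (design X *v x))\<^sup>2 = (\<Sum>i\<in>UNIV. (X i \<bullet> x)\<^sup>2)"
  by (simp only: power2_norm_eq_inner inner_vec_def[of "design X *v x"])
     (simp add: power2_eq_square)

lemma inner_design: "a \<bullet> (design X *v x) = (transpose (design X) *v a) \<bullet> x"
  by (rule inner_matrix_vector_mult)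

lemma gram_mult: "gram X *v a = design X *v (transpose (design X) *v a)"
  unfolding gram_eq_design by (simp only: matrix_vector_mul_assoc)

lemma inner_gram: "a \<bullet> (gram X *v a) = (norm (transpose (design X) *v a))\<^sup>2"
  by (simp only: gram_mult inner_design power2_norm_eq_inner)

lemma shifted_gram_mult: "(gram X + \<rho> *\<^sub>R mat 1) *v a = gram X *v a + \<rho> *\<^sub>R a"
  by (simp add: matrix_vector_mult_add_rdistrib scaleR_matrix_vector_assoc[symmetric])

section \<open>Invertibility and norm bounds for the shifted Gram matrix\<close>

lemma det_shifted_gram_nonzero:
  assumes "\<rho> > 0"
  shows "det (gram X + \<rho> *\<^sub>R mat 1) \<noteq> 0"
proof -
  have "a = 0" if "(gram X + \<rho> *\<^sub>R mat 1) *v a = 0" for a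
  proof -
    have "a \<bullet> (gram X *v a + \<rho> *\<^sub>R a) = 0"
      using that by (simp add: shifted_gram_mult)
    then have "(norm (transpose (design X) *v a))\<^sup>2 + \<rho> * (a \<bullet> a) = 0"
      by (simp only: inner_add_right inner_gram inner_scaleR_right)
    moreover have "(norm (transpose (design X) *v a))\<^sup>2 \<ge> 0" by (rule zero_le_power2)
    moreover have "\<rho> * (a \<bullet> a) \<ge> 0" using assms by simp
    ultimately have "\<rho> * (a \<bullet> a) = 0" by linarith
    with assms show ?thesis by simp
  qed
  then have "invertible (gram X + \<rho> *\<^sub>R mat 1)"
    unfolding invertible_left_inverse by (subst matrix_left_invertible_ker) simp
  then show ?thesis by (simp add: invertible_det_nz)
qed

lemma
  assumes "\<rho> > 0"
  shows shifted_gram_resolvent: "(gram X + \<rho> *\<^sub>R mat 1) ** resolvent X \<rho> = mat 1"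
    and resolvent_shifted_gram: "resolvent X \<rho> ** (gram X + \<rho> *\<^sub>R mat 1) = mat 1"
  using matrix_mult_matrix_inv[OF det_shifted_gram_nonzero[OF assms]]
    matrix_inv_mult_matrix[OF det_shifted_gram_nonzero[OF assms]]
  by (simp_all add: resolvent_def)

lemma gram_resolvent_mult:
  assumes "\<rho> > 0"
  shows "gram X *v (resolvent X \<rho> *v y) + \<rho> *\<^sub>R (resolvent X \<rho> *v y) = y"
proof -
  have "(gram X + \<rho> *\<^sub>R mat 1) *v (resolvent X \<rho> *v y) = y"
    by (simp add: matrix_vector_mul_assoc shifted_gram_resolvent[OF assms])
  then show ?thesis by (simp only: shifted_gram_mult)
qed

lemma transpose_resolvent:
  assumes "\<rho> > 0"
  shows "transpose (resolvent X \<rho>) = resolvent X \<rho>"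
proof -
  let ?L = "gram X + \<rho> *\<^sub>R mat 1"
  have "transpose ?L = ?L"
    by (simp add: vec_eq_iff transpose_def gram_def inner_commute mat_def)
  then have "transpose (resolvent X \<rho>) ** ?L = mat 1"
    using arg_cong[OF shifted_gram_resolvent[OF assms, of X], of transpose]
    by (simp add: matrix_transpose_mul)
  then have "transpose (resolvent X \<rho>) ** (?L ** resolvent X \<rho>) = resolvent X \<rho>"
    by (simp add: matrix_mul_assoc)
  then show ?thesis by (simp add: shifted_gram_resolvent[OF assms])
qed

lemma ridge_op_mult: "ridge_op X \<rho> *v x = transpose (design X) *v (resolvent X \<rho> *v (design X *v x))"
  unfolding ridge_op_def by (simp only: matrix_vector_mul_assoc matrix_mul_assoc)

lemma transpose_ridge_op:
  assumes "\<rho> > 0"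
  shows "transpose (ridge_op X \<rho>) = ridge_op X \<rho>"
  unfolding ridge_op_def by (simp add: matrix_transpose_mul transpose_resolvent[OF assms] matrix_mul_assoc)

text \<open>Pair \<open>y = K a + \<rho> a\<close>, where \<open>a\<close> is the resolvent applied
  to \<open>y\<close>, with \<open>a\<close>. Both upper bounds that follow come from this
  balance.\<close>

lemma resolvent_energy:
  assumes "\<rho> > 0"
  shows "(norm (transpose (design X) *v (resolvent X \<rho> *v y)))\<^sup>2 + \<rho> * (norm (resolvent X \<rho> *v y))\<^sup>2
    = (resolvent X \<rho> *v y) \<bullet> y"
proof -
  let ?a = "resolvent X \<rho> *v y"
  have "?a \<bullet> y = ?a \<bullet> (gram X *v ?a + \<rho> *\<^sub>R ?a)"
    by (simp only: gram_resolvent_mult[OF assms])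
  then show ?thesis
    by (simp only: inner_add_right inner_gram inner_scaleR_right power2_norm_eq_inner)
qed

text \<open>Drop the \<rho> term from the energy balance and apply Cauchy-Schwarz. The bound is
  uniform in the sample and supplies integrability later.\<close>

lemma norm_ridge_op_le:
  assumes "\<rho> > 0"
  shows "norm (ridge_op X \<rho> *v x) \<le> norm x"
proof -
  let ?a = "resolvent X \<rho> *v (design X *v x)"
  let ?w = "transpose (design X) *v ?a"
  have "\<rho> * (norm ?a)\<^sup>2 \<ge> 0" using assms by simp
  then have "(norm ?w)\<^sup>2 \<le> ?a \<bullet> (design X *v x)"
    using resolvent_energy[OF assms, of X "design X *v x"] by linarith
  also have "\<dots> = ?w \<bullet> x" by (rule inner_design)
  also have "\<dots> \<le> norm ?w * norm x" by (rule norm_cauchy_schwarz)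
  finally have "norm ?w * norm ?w \<le> norm ?w * norm x"
    by (simp only: power2_eq_square)
  then have "norm ?w \<le> norm x"
    by (cases "norm ?w = 0") auto
  then show ?thesis by (simp only: ridge_op_mult)
qed

text \<open>Here the \<rho> term of the energy balance is the one kept, the right side being at most
  the square of \<open>norm p\<close> by the contraction bound.\<close>

lemma norm_resolvent_design_le:
  assumes "\<rho> > 0"
  shows "(norm (resolvent X \<rho> *v (design X *v p)))\<^sup>2 \<le> (norm p)\<^sup>2 / \<rho>"
proof -
  let ?a = "resolvent X \<rho> *v (design X *v p)"
  let ?w = "transpose (design X) *v ?a"
  have "(norm ?w)\<^sup>2 + \<rho> * (norm ?a)\<^sup>2 = ?w \<bullet> p"
    using resolvent_energy[OF assms, of X "design X *v p"] by (simp only: inner_design)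
  also have "\<dots> \<le> norm ?w * norm p" by (rule norm_cauchy_schwarz)
  also have "\<dots> \<le> norm p * norm p"
    using norm_ridge_op_le[OF assms, of X p] by (intro mult_right_mono) (simp_all only: ridge_op_mult norm_ge_zero)
  finally have "(norm ?w)\<^sup>2 + \<rho> * (norm ?a)\<^sup>2 \<le> (norm p)\<^sup>2" by (simp only: power2_eq_square)
  moreover have "(norm ?w)\<^sup>2 \<ge> 0" by (rule zero_le_power2)
  ultimately have "\<rho> * (norm ?a)\<^sup>2 \<le> (norm p)\<^sup>2" by linarith
  with assms show ?thesis by (simp add: pos_le_divide_eq mult.commute)
qed

text \<open>With \<open>w = X^T a\<close>, row-wise Cauchy-Schwarz bounds the square of
  \<open>norm (K a)\<close> by a multiple of the square of \<open>norm w\<close>, which is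
  \<open>a \<bullet> K a\<close>. A second Cauchy-Schwarz lets one factor \<open>norm (K a)\<close>
  cancel.\<close>

lemma norm_gram_mult_le:
  fixes X :: "'m::finite \<Rightarrow> real^'n"
  assumes r: "\<And>i. norm (X i) \<le> r"
  shows "norm (gram X *v a) \<le> real CARD('m) * r\<^sup>2 * norm a"
proof -
  let ?w = "transpose (design X) *v a"
  have "(norm (gram X *v a))\<^sup>2 = (\<Sum>i\<in>UNIV. (X i \<bullet> ?w)\<^sup>2)"
    by (simp only: gram_mult norm_design_mult)
  also have "\<dots> \<le> (\<Sum>i\<in>(UNIV::'m set). r\<^sup>2 * (norm ?w)\<^sup>2)"
  proof (rule sum_mono)
    fix i
    have "\<bar>X i \<bullet> ?w\<bar> \<le> norm (X i) * norm ?w" by (rule Cauchy_Schwarz_ineq2)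
    also have "\<dots> \<le> r * norm ?w" by (intro mult_right_mono r norm_ge_zero)
    finally show "(X i \<bullet> ?w)\<^sup>2 \<le> r\<^sup>2 * (norm ?w)\<^sup>2"
      by (metis abs_ge_zero power2_abs power_mono power_mult_distrib)
  qed
  also have "\<dots> = real CARD('m) * r\<^sup>2 * (a \<bullet> (gram X *v a))"
    by (simp add: inner_gram)
  also have "\<dots> \<le> real CARD('m) * r\<^sup>2 * (norm a * norm (gram X *v a))"
    by (intro mult_left_mono norm_cauchy_schwarz) simp
  finally have "norm (gram X *v a) * norm (gram X *v a) \<le> norm (gram X *v a) * (real CARD('m) * r\<^sup>2 * norm a)"
    by (simp add: power2_eq_square mult_ac)
  then show ?thesis
    by (cases "norm (gram X *v a) = 0") auto
qed

text \<open>Since \<open>K + \<rho>\<close> stretches by at most the constant in the denominator,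
  its inverse shrinks by at most that constant. This is the source of the denominator in the noise
  term.\<close>

lemma norm_resolvent_ge:
  fixes X :: "'m::finite \<Rightarrow> real^'n"
  assumes "\<rho> > 0" and r: "\<And>i. norm (X i) \<le> r"
  shows "(norm y)\<^sup>2 / (real CARD('m) * r\<^sup>2 + \<rho>)\<^sup>2 \<le> (norm (resolvent X \<rho> *v y))\<^sup>2"
proof -
  let ?a = "resolvent X \<rho> *v y" and ?c = "real CARD('m) * r\<^sup>2 + \<rho>"
  have c: "?c > 0" using assms by (simp add: add_nonneg_pos)
  have "norm y = norm (gram X *v ?a + \<rho> *\<^sub>R ?a)"
    by (simp only: gram_resolvent_mult[OF assms(1)])
  also have "\<dots> \<le> norm (gram X *v ?a) + \<rho> * norm ?a"
    using norm_triangle_ineq[of "gram X *v ?a" "\<rho> *\<^sub>R ?a"] assms(1) by simp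
  also have "\<dots> \<le> ?c * norm ?a"
    using norm_gram_mult_le[of X r ?a] r by (simp add: algebra_simps)
  finally have "(norm y)\<^sup>2 \<le> (?c * norm ?a)\<^sup>2"
    by (intro power_mono) auto
  then show ?thesis using c by (simp add: pos_divide_le_eq power_mult_distrib mult.commute)
qed

section \<open>The ridge solution and the noiseless minimiser in weight space\<close>

lemma krr_eq_inner:
  "krr X Y \<rho> x = (transpose (design X) *v (resolvent X \<rho> *v (\<chi> i. Y i))) \<bullet> x"
proof -
  have "(\<chi> i. lin_kernel (X i) x) = design X *v x"
    by (simp add: vec_eq_iff lin_kernel_def)
  then have "krr X Y \<rho> x = (resolvent X \<rho> *v (\<chi> i. Y i)) \<bullet> (design X *v x)"
    by (simp add: krr_def resolvent_def gram_def lin_kernel_def inner_commute)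
  then show ?thesis by (simp only: inner_design)
qed

lemma krr_linear_target:
  "krr X (\<lambda>i. \<theta> \<bullet> X i + \<xi> i) \<rho> x =
     (ridge_op X \<rho> *v \<theta> + transpose (design X) *v (resolvent X \<rho> *v (\<chi> i. \<xi> i))) \<bullet> x"
proof -
  have "(\<chi> i. \<theta> \<bullet> X i + \<xi> i) = design X *v \<theta> + (\<chi> i. \<xi> i)"
    by (simp add: vec_eq_iff inner_commute)
  then show ?thesis
    by (simp only: krr_eq_inner matrix_vector_right_distrib ridge_op_mult)
qed

text \<open>Completing the square: the first order condition at the ridge weight removes the cross
  terms, leaving an exact quadratic remainder.\<close>

lemma ridge_objective_minimiser:
  assumes "\<rho> > 0"
  shows "ridge_objective X \<rho> (\<lambda>x. \<theta> \<bullet> x) v = ridge_objective X \<rho> (\<lambda>x. \<theta> \<bullet> x) (ridge_op X \<rho> *v \<theta>)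
      + (norm (design X *v (v - ridge_op X \<rho> *v \<theta>)))\<^sup>2 + \<rho> * (norm (v - ridge_op X \<rho> *v \<theta>))\<^sup>2"
proof -
  let ?w = "ridge_op X \<rho> *v \<theta>" and ?a = "resolvent X \<rho> *v (design X *v \<theta>)"
  let ?h = "v - ?w"
  have obj: "ridge_objective X \<rho> (\<lambda>x. \<theta> \<bullet> x) u = (norm (design X *v (u - \<theta>)))\<^sup>2 + \<rho> * (norm u)\<^sup>2" for u
    by (simp add: ridge_objective_def norm_design_mult inner_diff inner_commute)
  \<comment> \<open>The weight is \<open>X^T a\<close>, so \<open>X\<close> applied to it is
    \<open>K a = X \<theta> - \<rho> a\<close>: the residual on the sample is a multiple of the dual
    vector \<open>a\<close>.\<close>
  have "(design X *v (?w - \<theta>)) = - (\<rho> *\<^sub>R ?a)"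
    using gram_resolvent_mult[OF assms, of X "design X *v \<theta>"]
    by (simp only: matrix_vector_mult_diff_distrib ridge_op_mult gram_mult)
       (metis add_diff_cancel_left' minus_diff_eq)
  then have "(design X *v (?w - \<theta>)) \<bullet> (design X *v ?h) = - \<rho> * (?a \<bullet> (design X *v ?h))"
    by simp
  also have "?a \<bullet> (design X *v ?h) = ?w \<bullet> ?h"
    by (simp only: inner_design ridge_op_mult)
  finally have cross: "(design X *v (?w - \<theta>)) \<bullet> (design X *v ?h) + \<rho> * (?w \<bullet> ?h) = 0"
    by simp
  have 1: "design X *v (v - \<theta>) = design X *v (?w - \<theta>) + design X *v ?h"
    by (simp add: matrix_vector_right_distrib[symmetric])
  have 2: "(norm v)\<^sup>2 = (norm (?w + ?h))\<^sup>2" by simp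
  have sq: "(norm (x + y))\<^sup>2 = (norm x)\<^sup>2 + 2 * (x \<bullet> y) + (norm y)\<^sup>2" for x y :: "'z::real_inner"
    by (simp add: power2_norm_eq_inner inner_add inner_commute)
  show ?thesis
    unfolding obj 2 1 sq using cross by (simp add: algebra_simps)
qed

text \<open>The remainder contains a positive multiple of the squared distance to the ridge weight,
  so the minimiser is unique, as \<open>THE\<close> requires.\<close>

lemma Lambda_ridge_linear:
  assumes "\<rho> > 0"
  shows "Lambda_ridge X \<rho> (\<lambda>x. \<theta> \<bullet> x) = (\<lambda>x. (ridge_op X \<rho> *v \<theta>) \<bullet> x)"
proof -
  let ?w = "ridge_op X \<rho> *v \<theta>" and ?J = "ridge_objective X \<rho> (\<lambda>x. \<theta> \<bullet> x)"
  have "(THE w. \<forall>v. ?J w \<le> ?J v) = ?w"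
  proof (rule the_equality)
    have "?J ?w \<le> ?J v" for v
    proof -
      have "0 \<le> (norm (design X *v (v - ?w)))\<^sup>2" "0 \<le> \<rho> * (norm (v - ?w))\<^sup>2"
        using assms by auto
      then show ?thesis using ridge_objective_minimiser[OF assms, of X \<theta> v] by linarith
    qed
    then show "\<forall>v. ?J ?w \<le> ?J v" by blast
  next
    fix w assume "\<forall>v. ?J w \<le> ?J v"
    then have "?J w \<le> ?J ?w" by blast
    then have "(norm (design X *v (w - ?w)))\<^sup>2 + \<rho> * (norm (w - ?w))\<^sup>2 \<le> 0"
      using ridge_objective_minimiser[OF assms, of X \<theta> w] by linarith
    moreover have "(norm (design X *v (w - ?w)))\<^sup>2 \<ge> 0" by (rule zero_le_power2)
    ultimately have "\<rho> * (norm (w - ?w))\<^sup>2 \<le> 0" by linarith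
    then have "(norm (w - ?w))\<^sup>2 \<le> 0" using assms by (simp add: mult_le_0_iff)
    then show "w = ?w" by simp
  qed
  then show ?thesis by (simp add: Lambda_ridge_def)
qed

text \<open>Cyclicity of the trace turns the ridge operator into the product of resolvent and Gram
  matrix. That product acts on an eigenbasis of the Gram matrix by the factors
  \<open>D i / (D i + \<rho>)\<close>.\<close>

lemma
  assumes "\<rho> > 0" and ev: "eigenvalues_mult (gram X) \<gamma>"
  shows trace_ridge_op: "trace (ridge_op X \<rho>) = (\<Sum>i\<in>UNIV. \<gamma> i / (\<gamma> i + \<rho>))"
    and trace_ridge_op_square: "trace (ridge_op X \<rho> ** ridge_op X \<rho>) = (\<Sum>i\<in>UNIV. (\<gamma> i)\<^sup>2 / (\<gamma> i + \<rho>)\<^sup>2)"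
proof -
  let ?G = "resolvent X \<rho>" and ?K = "gram X"
  obtain b D where b: "orthonormal_family b" and D: "\<And>i. ?K *v b i = D i *\<^sub>R b i"
    using symmetric_matrix_orthonormal_eigenvectors[OF transpose_gram] by metis
  have bb: "b i \<bullet> b i = 1" for i using b by (simp add: orthonormal_family_def)
  \<comment> \<open>Ensures \<open>D i + \<rho>\<close> is nonzero, so that the resolvent can be
    solved for on \<open>b i\<close>.\<close>
  have D_nonneg: "D i \<ge> 0" for i
  proof -
    have "D i = b i \<bullet> (?K *v b i)" by (simp add: D bb)
    then show ?thesis by (simp only: inner_gram zero_le_power2)
  qed
  have GK: "(?G ** ?K) *v b i = (D i / (D i + \<rho>)) *\<^sub>R b i" for i
  proof -
    have "b i = ?G *v ((?K + \<rho> *\<^sub>R mat 1) *v b i)"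
      by (simp add: matrix_vector_mul_assoc resolvent_shifted_gram[OF assms(1)])
    also have "\<dots> = (D i + \<rho>) *\<^sub>R (?G *v b i)"
      by (simp add: shifted_gram_mult D scaleR_left_distrib[symmetric] matrix_vector_mult_scaleR)
    finally have "?G *v b i = (1 / (D i + \<rho>)) *\<^sub>R b i"
      using D_nonneg[of i] assms(1)
      by (metis add_nonneg_pos divide_inverse mult_1 scaleR_one scaleR_scaleR left_inverse less_irrefl)
    then show ?thesis
      by (simp add: matrix_vector_mul_assoc[symmetric] D matrix_vector_mult_scaleR)
  qed
  have "trace (ridge_op X \<rho>) = trace (?G ** ?K)"
    unfolding ridge_op_def gram_eq_design by (metis trace_mul_sym matrix_mul_assoc)
  also have "\<dots> = (\<Sum>i\<in>UNIV. D i / (D i + \<rho>))"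
    by (simp add: trace_orthonormal_family[OF b] GK bb)
  also have "\<dots> = (\<Sum>i\<in>UNIV. \<gamma> i / (\<gamma> i + \<rho>))"
    using sum_eigenvalues_mult[OF ev b D, of "\<lambda>t. t / (t + \<rho>)"] by simp
  finally show "trace (ridge_op X \<rho>) = (\<Sum>i\<in>UNIV. \<gamma> i / (\<gamma> i + \<rho>))" .
  have "ridge_op X \<rho> ** ridge_op X \<rho> = transpose (design X) ** (?G ** ?K ** ?G ** design X)"
    unfolding ridge_op_def gram_eq_design by (simp only: matrix_mul_assoc)
  then have "trace (ridge_op X \<rho> ** ridge_op X \<rho>) = trace ((?G ** ?K ** ?G ** design X) ** transpose (design X))"
    by (simp only: trace_mul_sym[of "transpose (design X)"])
  also have "\<dots> = trace ((?G ** ?K) ** (?G ** ?K))"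
    unfolding gram_eq_design by (simp only: matrix_mul_assoc)
  also have "\<dots> = (\<Sum>i\<in>UNIV. (D i)\<^sup>2 / (D i + \<rho>)\<^sup>2)"
    unfolding trace_orthonormal_family[OF b]
    by (simp only: matrix_vector_mul_assoc[symmetric, of "?G ** ?K"] GK matrix_vector_mult_scaleR)
       (simp add: bb power2_eq_square)
  also have "\<dots> = (\<Sum>i\<in>UNIV. (\<gamma> i)\<^sup>2 / (\<gamma> i + \<rho>)\<^sup>2)"
    using sum_eigenvalues_mult[OF ev b D, of "\<lambda>t. t\<^sup>2 / (t + \<rho>)\<^sup>2"] by simp
  finally show "trace (ridge_op X \<rho> ** ridge_op X \<rho>) = (\<Sum>i\<in>UNIV. (\<gamma> i)\<^sup>2 / (\<gamma> i + \<rho>)\<^sup>2)" .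
qed

text \<open>A common rotation of the inputs leaves all inner products, hence the resolvent,
  unchanged; only the two outer design factors rotate.\<close>

lemma ridge_op_rotate:
  assumes Q: "orthogonal_matrix Q"
  shows "ridge_op (\<lambda>i. Q *v X i) \<rho> = Q ** ridge_op X \<rho> ** transpose Q"
proof -
  have "resolvent (\<lambda>i. Q *v X i) \<rho> = resolvent X \<rho>"
    by (simp add: resolvent_def gram_def inner_orthogonal_matrix_mult[OF Q])
  moreover have "design (\<lambda>i. Q *v X i) = design X ** transpose Q"
    by (simp add: design_def vec_eq_iff matrix_matrix_mult_def transpose_def matrix_vector_mult_def mult.commute)
  ultimately show ?thesis
    by (simp add: ridge_op_def matrix_transpose_mul matrix_mul_assoc)
qed

lemma inner_ridge_op_rotate:
  assumes Q: "orthogonal_matrix Q"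
  shows "(Q *v u) \<bullet> (ridge_op (\<lambda>i. Q *v X i) \<rho> *v (Q *v v)) = u \<bullet> (ridge_op X \<rho> *v v)"
proof -
  have QQ: "transpose Q ** Q = mat 1" using Q by (simp add: orthogonal_matrix_def)
  have "ridge_op (\<lambda>i. Q *v X i) \<rho> *v (Q *v v) = (Q ** ridge_op X \<rho> ** (transpose Q ** Q)) *v v"
    by (simp only: ridge_op_rotate[OF Q] matrix_vector_mul_assoc matrix_mul_assoc)
  also have "\<dots> = Q *v (ridge_op X \<rho> *v v)"
    by (simp add: QQ matrix_vector_mul_assoc)
  finally show ?thesis by (simp only: inner_orthogonal_matrix_mult[OF Q])
qed

text \<open>Lagrange's identity for the diagonal, plus the off-diagonal squares. On the right every
  summand is, up to a constant, the square of some \<open>u \<bullet> A v\<close> with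
  \<open>u\<close> orthogonal to \<open>v\<close>, or zero.\<close>

lemma trace_symmetric_square_identity:
  fixes A :: "real^'n^'n"
  assumes sym: "transpose A = A"
  shows "real CARD('n) * trace (A ** A) - (trace A)\<^sup>2 =
    (\<Sum>i\<in>UNIV. \<Sum>j\<in>UNIV. (A $ i $ i - A $ j $ j)\<^sup>2) / 2
      + real CARD('n) * (\<Sum>i\<in>UNIV. \<Sum>j\<in>UNIV - {i}. (A $ i $ j)\<^sup>2)"
proof -
  have A: "A $ j $ i = A $ i $ j" for i j
    using arg_cong[OF sym, of "\<lambda>M. M $ i $ j"] by (simp add: transpose_def)
  let ?d = "real CARD('n)" and ?s = "\<Sum>i\<in>UNIV. (A $ i $ i)\<^sup>2"
  have "trace (A ** A) = (\<Sum>i\<in>UNIV. \<Sum>j\<in>UNIV. (A $ i $ j)\<^sup>2)"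
    by (simp add: trace_def matrix_matrix_mult_def power2_eq_square A)
  also have "\<dots> = (\<Sum>i\<in>UNIV. (A $ i $ i)\<^sup>2 + (\<Sum>j\<in>UNIV - {i}. (A $ i $ j)\<^sup>2))"
    by (intro sum.cong refl sum.remove) auto
  finally have tr: "trace (A ** A) = ?s + (\<Sum>i\<in>UNIV. \<Sum>j\<in>UNIV - {i}. (A $ i $ j)\<^sup>2)"
    by (simp add: sum.distrib)
  have "(\<Sum>i\<in>UNIV. \<Sum>j\<in>UNIV. (A $ i $ i - A $ j $ j)\<^sup>2)
      = (\<Sum>i\<in>UNIV. \<Sum>j\<in>UNIV. (A $ i $ i)\<^sup>2 + (A $ j $ j)\<^sup>2 - 2 * (A $ i $ i * A $ j $ j))"
    by (simp add: power2_diff mult.assoc)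
  also have "\<dots> = ?d * ?s + ?d * ?s - 2 * (trace A)\<^sup>2"
    by (simp add: sum.distrib sum_subtractf sum_distrib_left[symmetric] trace_def power2_eq_square sum_product)
  finally show ?thesis by (simp add: tr algebra_simps)
qed

section \<open>The averaged representation\<close>

lemma matrix_diff_ldistrib: "A ** (B - C) = A ** B - A ** C" for A :: "'a::comm_ring_1^'n^'m"
  by (simp add: vec_eq_iff matrix_matrix_mult_def sum_subtractf algebra_simps)

lemma matrix_diff_rdistrib: "(A - B) ** C = A ** C - B ** C" for C :: "'a::comm_ring_1^'n^'m"
  by (simp add: vec_eq_iff matrix_matrix_mult_def sum_subtractf algebra_simps)

lemma frobenius_norm_square: "(frobenius_norm A)\<^sup>2 = trace (transpose A ** A)"
proof -
  have "(frobenius_norm A)\<^sup>2 = (\<Sum>i\<in>UNIV. \<Sum>j\<in>UNIV. (A $ i $ j)\<^sup>2)"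
    by (simp add: frobenius_norm_def sum_nonneg)
  also have "\<dots> = (\<Sum>j\<in>UNIV. \<Sum>i\<in>UNIV. (A $ i $ j)\<^sup>2)" by (rule sum.swap)
  finally show ?thesis
    by (simp add: trace_def matrix_matrix_mult_def transpose_def power2_eq_square)
qed

lemma frobenius_norm_square_rows: "(frobenius_norm A)\<^sup>2 = (\<Sum>i\<in>UNIV. (norm (A $ i))\<^sup>2)"
  unfolding power2_norm_eq_inner inner_vec_def
  by (simp add: frobenius_norm_def sum_nonneg power2_eq_square)

lemma norm_matrix_mult_square: "(norm (A *v x))\<^sup>2 = (\<Sum>i\<in>UNIV. (A $ i \<bullet> x)\<^sup>2)" for A :: "real^'n^'m"
  unfolding power2_norm_eq_inner inner_vec_def[of "A *v x"]
  by (simp add: matrix_vector_mul_component power2_eq_square)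

text \<open>A crude bound by the sum of the row norms; it is enough to make the representation
  Bochner integrable.\<close>

lemma norm_orthogonal_matrix_le:
  fixes A :: "real^'n^'n"
  assumes "orthogonal_matrix A"
  shows "norm A \<le> real CARD('n)"
proof -
  have "norm (A $ i) = 1" for i
    using assms unfolding orthogonal_matrix_orthonormal_rows by (simp add: row_def)
  moreover have "norm A \<le> (\<Sum>i\<in>UNIV. norm (A $ i))"
    unfolding norm_vec_def by (rule L2_set_le_sum) simp
  ultimately show ?thesis by simp
qed

lemma linear_matrix_mult_left: "linear (\<lambda>M :: real^'n^'n. A ** M)" for A :: "real^'n^'n"
  by (rule linearI) (simp_all add: matrix_add_ldistrib matrix_scalar_ac scalar_matrix_assoc)

section \<open>The Haar average as an orthogonal projection\<close>

text \<open>Only left invariance of the Haar measure is available, and it suffices: it gives \<open>\<phi> a ** avg = avg\<close>,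
 hence by orthogonality \<open>transpose (\<phi> a) ** avg = avg\<close>, and integrating over \<open>a\<close> yields
 \<open>transpose avg ** avg = avg\<close>, so \<open>avg\<close> is symmetric and idempotent.\<close>

locale averaged_orth_rep =
  fixes gmul :: "'g::{t2_space,second_countable_topology} \<Rightarrow> 'g \<Rightarrow> 'g"
    and e :: 'g and ginv :: "'g \<Rightarrow> 'g" and lam :: "'g measure" and \<phi> :: "'g \<Rightarrow> real^'n^'n"
  assumes haar: "haar_compact_group gmul e ginv lam" and rep: "orth_rep gmul lam \<phi>"
begin

sublocale prob_space lam
  using haar by (simp add: haar_compact_group_def)

definition avg :: "real^'n^'n" where "avg = integral\<^sup>L lam \<phi>"

definition coavg :: "real^'n^'n" where "coavg = mat 1 - avg"

lemma orthogonal_rep: "orthogonal_matrix (\<phi> a)"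
  using rep by (simp add: orth_rep_def)

lemma integrable_rep: "integrable lam \<phi>"
proof (rule integrable_const_bound)
  show "AE g in lam. norm (\<phi> g) \<le> real CARD('n)"
    by (simp add: norm_orthogonal_matrix_le[OF orthogonal_rep])
  show "\<phi> \<in> borel_measurable lam" using rep by (simp add: orth_rep_def)
qed

text \<open>Integration commutes with linear maps. Identities for the average follow by choosing the
  map: left multiplication, multiplication of the transpose, or a matrix coefficient.\<close>

lemma integral_linear_rep:
  fixes h :: "real^'n^'n \<Rightarrow> 'b::euclidean_space"
  assumes "linear h"
  shows "(\<integral>g. h (\<phi> g) \<partial>lam) = h avg"
  unfolding avg_def using assms integrable_rep
  by (intro integral_bounded_linear) (simp_all add: linear_conv_bounded_linear)

lemma sets_haar: "sets lam = sets borel"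
  using haar by (simp add: haar_compact_group_def)

lemma measurable_left_translation: "gmul a \<in> measurable lam lam"
proof -
  have "continuous_on UNIV (\<lambda>p. gmul (fst p) (snd p))"
    using haar by (simp add: haar_compact_group_def)
  from continuous_on_compose2[OF this, of UNIV "\<lambda>b. (a, b)"]
  have "continuous_on UNIV (gmul a)" by (simp add: continuous_on_Pair)
  then have "gmul a \<in> borel_measurable borel"
    by (rule borel_measurable_continuous_onI)
  then show ?thesis unfolding measurable_cong_sets[OF sets_haar sets_haar] .
qed

lemma distr_left_translation: "distr lam lam (gmul a) = lam"
proof (rule measure_eqI)
  show "emeasure (distr lam lam (gmul a)) A = emeasure lam A" if "A \<in> sets (distr lam lam (gmul a))" for A
  proof -
    have "space lam = UNIV" using sets_eq_imp_space_eq[OF sets_haar] by simp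
    then show ?thesis
      using that measurable_left_translation haar by (simp add: emeasure_distr haar_compact_group_def)
  qed
qed simp

lemma rep_avg: "\<phi> a ** avg = avg"
proof -
  have meas: "\<phi> \<in> borel_measurable lam" using rep by (simp add: orth_rep_def)
  have "avg = integral\<^sup>L (distr lam lam (gmul a)) \<phi>"
    by (simp add: avg_def distr_left_translation)
  also have "\<dots> = (\<integral>g. \<phi> (gmul a g) \<partial>lam)"
    using measurable_left_translation meas by (rule integral_distr)
  also have "\<dots> = (\<integral>g. \<phi> a ** \<phi> g \<partial>lam)" using rep by (simp add: orth_rep_def)
  also have "\<dots> = \<phi> a ** avg" by (rule integral_linear_rep[OF linear_matrix_mult_left])
  finally show ?thesis by simp
qed

lemma
  shows transpose_avg: "transpose avg = avg" and avg_idem: "avg ** avg = avg"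
proof -
  have *: "transpose (\<phi> a) ** avg = avg" for a
  proof -
    have "transpose (\<phi> a) ** avg = transpose (\<phi> a) ** (\<phi> a ** avg)" by (simp only: rep_avg)
    also have "\<dots> = avg" using orthogonal_rep[of a] by (simp add: matrix_mul_assoc orthogonal_matrix_def)
    finally show ?thesis .
  qed
  have "linear (\<lambda>M :: real^'n^'n. transpose M ** avg)"
    by (rule linearI)
      (simp_all add: vec_eq_iff matrix_matrix_mult_def transpose_def sum.distrib algebra_simps sum_distrib_left)
  from integral_linear_rep[OF this] have eq: "transpose avg ** avg = avg"
    by (simp add: * prob_space)
  then have "transpose (transpose avg ** avg) = transpose avg" by simp
  moreover have "transpose (transpose avg ** avg) = transpose avg ** avg"
    by (simp only: matrix_transpose_mul transpose_transpose)
  ultimately show sym: "transpose avg = avg" by (simp only: eq)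
  show "avg ** avg = avg" using eq by (simp only: sym)
qed

lemma
  shows transpose_coavg: "transpose coavg = coavg" and coavg_idem: "coavg ** coavg = coavg"
proof -
  show "transpose coavg = coavg"
    using arg_cong[OF transpose_avg, of "\<lambda>M. mat 1 - M"]
    by (simp add: coavg_def vec_eq_iff transpose_def mat_def)
  show "coavg ** coavg = coavg"
    by (simp add: coavg_def matrix_diff_ldistrib matrix_diff_rdistrib avg_idem)
qed

text \<open>For an orthogonal projection the squared Frobenius norm is its trace, and traces of
  complementary projections add up to the dimension.\<close>

lemma frobenius_coavg: "(frobenius_norm coavg)\<^sup>2 = real CARD('n) - (frobenius_norm avg)\<^sup>2"
  unfolding frobenius_norm_square transpose_avg transpose_coavg avg_idem coavg_idem
  by (simp add: coavg_def trace_sub trace_I)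

lemma integral_inner_rep: "(\<integral>g. w \<bullet> (\<phi> g *v x) \<partial>lam) = (avg *v w) \<bullet> x"
proof -
  have "linear (\<lambda>M :: real^'n^'n. w \<bullet> (M *v x))"
    by (rule linearI)
      (simp_all add: matrix_vector_mult_add_rdistrib inner_add scaleR_matrix_vector_assoc[symmetric])
  from integral_linear_rep[OF this] show ?thesis
    using inner_matrix_vector_mult[of w avg x] by (simp only: transpose_avg)
qed

lemma orbit_avg_linear: "orbit_avg lam \<phi> (\<lambda>x. w \<bullet> x) = (\<lambda>x. (avg *v w) \<bullet> x)"
  by (simp add: orbit_avg_def integral_inner_rep fun_eq_iff)

lemma kperp_eq: "kperp lam \<phi> x y = (coavg *v x) \<bullet> y"
  by (simp add: kperp_def lin_kernel_def integral_inner_rep coavg_def matrix_vector_mult_diff_rdistrib inner_diff)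

text \<open>Invariance is given only on the sphere; scaling carries it to all vectors, and
  integrating over the group then gives the claim.\<close>

lemma avg_invariant_vector:
  assumes inv: "\<And>g x. x \<in> sphere 0 r \<Longrightarrow> \<theta> \<bullet> (\<phi> g *v x) = \<theta> \<bullet> x" and r: "r > 0"
  shows "avg *v \<theta> = \<theta>"
proof -
  have "\<theta> \<bullet> (\<phi> g *v x) = \<theta> \<bullet> x" for g x
  proof (cases "x = 0")
    case False
    have "(r / norm x) *\<^sub>R x \<in> sphere 0 r" using False r by simp
    from inv[OF this, of g] False r show ?thesis
      by (simp add: matrix_vector_mult_scaleR)
  qed simp
  then have "(avg *v \<theta>) \<bullet> x = \<theta> \<bullet> x" for x
    using integral_inner_rep[of \<theta> x] by (simp add: prob_space)
  then show ?thesis by (metis vector_eq_rdot)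
qed

text \<open>As \<theta> is fixed, \<open>avg *v w - \<theta>\<close> lies in the range of the
  projection \<open>avg\<close>, hence is orthogonal to \<open>coavg *v w\<close>. Averaging a
  predictor therefore saves exactly the last summand.\<close>

lemma pythagoras_avg:
  assumes "avg *v \<theta> = \<theta>"
  shows "(norm (w - \<theta>))\<^sup>2 = (norm (avg *v w - \<theta>))\<^sup>2 + (norm (coavg *v w))\<^sup>2"
proof -
  have "(coavg *v w) \<bullet> (avg *v w - \<theta>) = 0"
  proof -
    have "avg *v w - \<theta> = avg *v (w - \<theta>)" by (simp add: assms matrix_vector_mult_diff_distrib)
    then have "(coavg *v w) \<bullet> (avg *v w - \<theta>) = (transpose avg *v (coavg *v w)) \<bullet> (w - \<theta>)"
      by (simp only: inner_matrix_vector_mult)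
    also have "transpose avg *v (coavg *v w) = (avg ** coavg) *v w"
      by (simp only: transpose_avg matrix_vector_mul_assoc)
    also have "avg ** coavg = 0" by (simp add: coavg_def matrix_diff_ldistrib avg_idem)
    finally show ?thesis by simp
  qed
  moreover have "w - \<theta> = (avg *v w - \<theta>) + coavg *v w"
    by (simp add: coavg_def matrix_vector_mult_diff_rdistrib)
  ultimately show ?thesis
    by (simp only: power2_norm_eq_inner) (simp add: inner_add inner_commute)
qed

text \<open>Supplies the orthogonality under which the second moments of the ridge operator are
  known.\<close>

lemma coavg_row_orthogonal:
  assumes "avg *v \<theta> = \<theta>"
  shows "coavg $ k \<bullet> \<theta> = 0"
proof -
  have "coavg *v \<theta> = 0" by (simp add: coavg_def matrix_vector_mult_diff_rdistrib assms)
  then have "(coavg *v \<theta>) $ k = 0" by simp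
  then show ?thesis by (simp add: matrix_vector_mul_component)
qed

end

section \<open>Measurability\<close>

text \<open>For a non-measurable map \<open>distr\<close> is built from the junk value 0 of \<open>emeasure\<close> on
 non-measurable preimages; a set and its complement would then both have measure 0.\<close>

lemma prob_space_distr_imp_measurable:
  assumes "prob_space (distr M N X)" and maps: "X \<in> space M \<rightarrow> space N"
  shows "X \<in> measurable M N"
proof (rule measurableI)
  show "X x \<in> space N" if "x \<in> space M" for x using that maps by auto
next
  interpret D: prob_space "distr M N X" by fact
  let ?m = "\<lambda>A. emeasure M (X -` A \<inter> space M)"
  fix A assume A: "A \<in> sets N"
  have "emeasure (distr M N X) (space N) = 1" using D.emeasure_space_1 by simp
  \<comment> \<open>If the pushed-forward set function were not a measure, \<open>measure_of\<close>
    would default to zero everywhere; total mass 1 excludes this.\<close>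
  then have ms: "measure_space (space N) (sets N) ?m"
    unfolding distr_def by (metis emeasure_measure_of_conv sets.sigma_sets_eq zero_neq_one sets.space_closed)
  then have eq: "emeasure (distr M N X) B = ?m B" if "B \<in> sets N" for B
    unfolding distr_def using that sets.space_closed[of N]
    by (simp add: emeasure_measure_of_conv sets.sigma_sets_eq)
  show "X -` A \<inter> space M \<in> sets M"
  proof (rule ccontr)
    assume non: "X -` A \<inter> space M \<notin> sets M"
    have "X -` (space N - A) \<inter> space M = space M - (X -` A \<inter> space M)" using maps by auto
    then have "X -` (space N - A) \<inter> space M \<notin> sets M"
      using non by (metis inf_le2 double_diff sets.Diff sets.top order_refl)
    then have "emeasure (distr M N X) A = 0" "emeasure (distr M N X) (space N - A) = 0"
      using non A by (simp_all add: eq emeasure_notin_sets)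
    then have "emeasure (distr M N X) (A \<union> (space N - A)) = 0"
      using A by (subst plus_emeasure[symmetric]) auto
    moreover have "A \<union> (space N - A) = space N" using sets.sets_into_space[OF A] by blast
    ultimately show False using D.emeasure_space_1 by simp
  qed
qed

section \<open>Determinants, inverses and the ridge operator as measurable functions of the
  sample\<close>

lemma borel_measurable_det:
  fixes A :: "'a \<Rightarrow> real^'m^'m"
  assumes [measurable]: "\<And>i j. (\<lambda>\<omega>. A \<omega> $ i $ j) \<in> borel_measurable M"
  shows "(\<lambda>\<omega>. det (A \<omega>)) \<in> borel_measurable M"
  unfolding det_def by measurable

text \<open>By Cramer's rule an entry of the inverse is a quotient of two determinants, which are
  polynomials in measurable entries.\<close>

lemma borel_measurable_matrix_inv_component:
  fixes A :: "'a \<Rightarrow> real^'m^'m"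
  assumes [measurable]: "\<And>i j. (\<lambda>\<omega>. A \<omega> $ i $ j) \<in> borel_measurable M"
    and det: "\<And>\<omega>. det (A \<omega>) \<noteq> 0"
  shows "(\<lambda>\<omega>. matrix_inv (A \<omega>) $ i $ k) \<in> borel_measurable M"
proof -
  let ?C = "\<lambda>\<omega>. (\<chi> a b. if b = i then axis k 1 $ a else A \<omega> $ a $ b) :: real^'m^'m"
  have "matrix_inv (A \<omega>) $ i $ k = det (?C \<omega>) / det (A \<omega>)" for \<omega>
  proof -
    have "A \<omega> *v (matrix_inv (A \<omega>) *v axis k 1) = axis k 1"
      by (simp add: matrix_vector_mul_assoc matrix_mult_matrix_inv[OF det])
    from this[unfolded cramer[OF det]]
    have "(matrix_inv (A \<omega>) *v axis k 1) $ i = det (?C \<omega>) / det (A \<omega>)" by simp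
    then show ?thesis by (simp add: matrix_vector_mult_basis column_def)
  qed
  moreover have "(\<lambda>\<omega>. det (?C \<omega>)) \<in> borel_measurable M"
    by (rule borel_measurable_det) simp
  moreover have "(\<lambda>\<omega>. det (A \<omega>)) \<in> borel_measurable M"
    by (rule borel_measurable_det) simp
  ultimately show ?thesis by simp
qed

lemma borel_measurable_resolvent_component:
  fixes X :: "'a \<Rightarrow> 'm::finite \<Rightarrow> real^'n"
  assumes [measurable]: "\<And>i. (\<lambda>\<omega>. X \<omega> i) \<in> borel_measurable M" and "\<rho> > 0"
  shows "(\<lambda>\<omega>. resolvent (X \<omega>) \<rho> $ i $ j) \<in> borel_measurable M"
  unfolding resolvent_def
proof (rule borel_measurable_matrix_inv_component)
  show "(\<lambda>\<omega>. (gram (X \<omega>) + \<rho> *\<^sub>R mat 1) $ i $ j) \<in> borel_measurable M" for i j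
    by (simp add: gram_def)
qed (rule det_shifted_gram_nonzero[OF \<open>\<rho> > 0\<close>])

lemma borel_measurable_resolvent_design_component:
  fixes X :: "'a \<Rightarrow> 'm::finite \<Rightarrow> real^'n"
  assumes X [measurable]: "\<And>i. (\<lambda>\<omega>. X \<omega> i) \<in> borel_measurable M" and \<rho>: "\<rho> > 0"
  shows "(\<lambda>\<omega>. (resolvent (X \<omega>) \<rho> *v (design (X \<omega>) *v p)) $ i) \<in> borel_measurable M"
proof -
  have [measurable]: "(\<lambda>\<omega>. resolvent (X \<omega>) \<rho> $ i $ j) \<in> borel_measurable M" for i j
    using X \<rho> by (rule borel_measurable_resolvent_component)
  show ?thesis
    unfolding matrix_vector_mul_component[of "resolvent _ _"] inner_vec_def by simp
qed

text \<open>The measure space is left general because the result is applied to the underlying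
  probability space, to the product space of samples, and to the sigma-algebra generated by the
  sample.\<close>

lemma borel_measurable_ridge_op:
  fixes X :: "'a \<Rightarrow> 'm::finite \<Rightarrow> real^'n"
  assumes X [measurable]: "\<And>i. (\<lambda>\<omega>. X \<omega> i) \<in> borel_measurable M" and \<rho>: "\<rho> > 0"
  shows "(\<lambda>\<omega>. u \<bullet> (ridge_op (X \<omega>) \<rho> *v v)) \<in> borel_measurable M"
proof -
  have [measurable]: "(\<lambda>\<omega>. (resolvent (X \<omega>) \<rho> *v (design (X \<omega>) *v v)) $ i) \<in> borel_measurable M" for i
    using X \<rho> by (rule borel_measurable_resolvent_design_component)
  have "u \<bullet> (ridge_op (X \<omega>) \<rho> *v v) = (\<Sum>i\<in>UNIV. (resolvent (X \<omega>) \<rho> *v (design (X \<omega>) *v v)) $ i * (X \<omega> i \<bullet> u))" for \<omega>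
  proof -
    have "u \<bullet> (ridge_op (X \<omega>) \<rho> *v v) = (resolvent (X \<omega>) \<rho> *v (design (X \<omega>) *v v)) \<bullet> (design (X \<omega>) *v u)"
      by (simp only: inner_design ridge_op_mult inner_commute[of u])
    then show ?thesis by (simp add: inner_vec_def[of "resolvent _ _ *v _"])
  qed
  then show ?thesis by simp
qed

section \<open>The uniform distribution on a sphere\<close>

locale sphere_uniform =
  fixes r :: real and \<mu> :: "(real^'n) measure"
  assumes uniform: "uniform_sphere r \<mu>"
begin

sublocale prob_space \<mu> using uniform by (simp add: uniform_sphere_def)

lemma sets_eq [measurable_cong]: "sets \<mu> = sets borel"
  using uniform by (simp add: uniform_sphere_def)

lemma AE_norm: "AE x in \<mu>. norm x = r"
proof -
  have "AE x in \<mu>. x \<in> sphere 0 r"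
    using uniform by (intro AE_prob_1) (simp add: uniform_sphere_def measure_def)
  then show ?thesis by simp
qed

lemma integral_rotate:
  fixes h :: "real^'n \<Rightarrow> real"
  assumes Q: "orthogonal_matrix Q" and h: "h \<in> borel_measurable borel"
  shows "(\<integral>x. h (Q *v x) \<partial>\<mu>) = (\<integral>x. h x \<partial>\<mu>)"
proof -
  have Qm: "(\<lambda>x. Q *v x) \<in> measurable \<mu> borel"
    by (simp add: measurable_cong_sets[OF sets_eq refl] borel_measurable_continuous_onI continuous_intros)
  have "(\<integral>x. h x \<partial>\<mu>) = (\<integral>x. h x \<partial>distr \<mu> borel (\<lambda>x. Q *v x))"
    using uniform Q by (simp add: uniform_sphere_def)
  also have "\<dots> = (\<integral>x. h (Q *v x) \<partial>\<mu>)"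
    using Qm h by (rule integral_distr)
  finally show ?thesis by simp
qed

lemma integrable_inner_square: "integrable \<mu> (\<lambda>x. (v \<bullet> x)\<^sup>2)"
proof (rule integrable_const_bound)
  show "AE x in \<mu>. norm ((v \<bullet> x)\<^sup>2) \<le> (norm v * r)\<^sup>2"
    using AE_norm
  proof eventually_elim
    fix x :: "real^'n" assume "norm x = r"
    then have "\<bar>v \<bullet> x\<bar> \<le> norm v * r" using Cauchy_Schwarz_ineq2[of v x] by simp
    then show "norm ((v \<bullet> x)\<^sup>2) \<le> (norm v * r)\<^sup>2" by (metis abs_ge_zero norm_power power_mono real_norm_def)
  qed
qed measurable

text \<open>By rotation invariance the integral depends only on \<open>norm v\<close>, and
  quadratically. The coordinate axes contribute equal shares of the total, the integral of the
  squared norm.\<close>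

lemma integral_inner_square: "(\<integral>x. (v \<bullet> x)\<^sup>2 \<partial>\<mu>) = (norm v)\<^sup>2 * r\<^sup>2 / real CARD('n)"
proof -
  have same: "(\<integral>x. (u \<bullet> x)\<^sup>2 \<partial>\<mu>) = (\<integral>x. (u' \<bullet> x)\<^sup>2 \<partial>\<mu>)" if "norm u = norm u'" for u u' :: "real^'n"
  proof -
    obtain Q where Q: "orthogonal_matrix Q" "Q *v u = u'"
      using householder_reflection[OF \<open>norm u = norm u'\<close>] by metis
    have "(Q *v u) \<bullet> (Q *v x) = u \<bullet> x" for x
      by (rule inner_orthogonal_matrix_mult[OF Q(1)])
    then show ?thesis
      using integral_rotate[OF Q(1), of "\<lambda>x. (u' \<bullet> x)\<^sup>2"] Q(2) by simp
  qed
  have coord: "(\<integral>x. (axis i 1 \<bullet> x)\<^sup>2 \<partial>\<mu>) = (\<integral>x. (axis j 1 \<bullet> x)\<^sup>2 \<partial>\<mu>)" for i j :: 'n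
    by (rule same) simp
  have total: "(\<Sum>i\<in>UNIV. (\<integral>x. (axis i 1 \<bullet> x)\<^sup>2 \<partial>\<mu>)) = r\<^sup>2"
  proof -
    have "(\<Sum>i\<in>UNIV. (\<integral>x. (axis i 1 \<bullet> x)\<^sup>2 \<partial>\<mu>)) = (\<integral>x. (\<Sum>i\<in>UNIV. (axis i 1 \<bullet> x)\<^sup>2) \<partial>\<mu>)"
      by (subst Bochner_Integration.integral_sum) (simp_all only: integrable_inner_square)
    also have "\<dots> = (\<integral>x. r\<^sup>2 \<partial>\<mu>)"
    proof (rule integral_cong_AE)
      show "AE x in \<mu>. (\<Sum>i\<in>UNIV. (axis i 1 \<bullet> x)\<^sup>2) = r\<^sup>2"
        using AE_norm
        by eventually_elim
          (simp add: parseval_orthonormal_family[of "\<lambda>i. axis i 1", symmetric] orthonormal_family_def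
            inner_axis_axis)
    qed measurable
    finally show ?thesis by (simp add: prob_space)
  qed
  have axis: "(\<integral>x. (axis k 1 \<bullet> x)\<^sup>2 \<partial>\<mu>) = r\<^sup>2 / real CARD('n)" for k :: 'n
  proof -
    have "(\<Sum>i\<in>UNIV. (\<integral>x. (axis i 1 \<bullet> x)\<^sup>2 \<partial>\<mu>)) = (\<Sum>i\<in>(UNIV::'n set). (\<integral>x. (axis k 1 \<bullet> x)\<^sup>2 \<partial>\<mu>))"
      by (intro sum.cong refl coord)
    with total show ?thesis by (simp add: field_simps)
  qed
  let ?e = "axis (undefined :: 'n) 1"
  have "(\<integral>x. (v \<bullet> x)\<^sup>2 \<partial>\<mu>) = (\<integral>x. ((norm v *\<^sub>R ?e) \<bullet> x)\<^sup>2 \<partial>\<mu>)"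
    by (rule same) simp
  also have "\<dots> = (norm v)\<^sup>2 * (\<integral>x. (?e \<bullet> x)\<^sup>2 \<partial>\<mu>)"
    by (simp add: power_mult_distrib)
  finally show ?thesis by (simp add: axis)
qed

end

section \<open>Moments over the random sample\<close>

lemma ex_distinct_of_card: "CARD('n::finite) > 1 \<Longrightarrow> \<exists>k l :: 'n. k \<noteq> l"
  by (metis One_nat_def UNIV_I card_1_singleton_iff less_irrefl UNIV_eq_I singletonI)

text \<open>A bounded factor measurable for the subalgebra can be pulled out. All noise moments are
  evaluated this way, with \<open>k\<close> equal to 0 or 1.\<close>

lemma (in finite_measure_subalgebra) integral_mult_cond_exp_const:
  assumes f [measurable]: "f \<in> borel_measurable F" and bound: "AE x in M. \<bar>f x\<bar> \<le> B"
    and g: "integrable M g" and cond: "AE x in M. real_cond_exp M F g x = k"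
  shows "integrable M (\<lambda>x. f x * g x)" "(\<integral>x. f x * g x \<partial>M) = k * (\<integral>x. f x \<partial>M)"
proof -
  have fM [measurable]: "f \<in> borel_measurable M" by (rule measurable_from_subalg[OF subalg f])
  have [measurable]: "g \<in> borel_measurable M" using g by simp
  show int: "integrable M (\<lambda>x. f x * g x)"
  proof (rule Bochner_Integration.integrable_bound)
    show "integrable M (\<lambda>x. B * g x)" using g by simp
    show "AE x in M. norm (f x * g x) \<le> norm (B * g x)"
      using bound
    proof eventually_elim
      fix x assume "\<bar>f x\<bar> \<le> B"
      then have "\<bar>f x\<bar> \<le> \<bar>B\<bar>" by linarith
      then show "norm (f x * g x) \<le> norm (B * g x)" by (simp add: abs_mult mult_right_mono)
    qed
  qed measurable
  have "(\<integral>x. f x * g x \<partial>M) = (\<integral>x. f x * real_cond_exp M F g x \<partial>M)"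
    using int by (intro real_cond_exp_intg(2)[symmetric]) auto
  also have "\<dots> = (\<integral>x. k * f x \<partial>M)"
  proof (rule integral_cong_AE)
    show "AE x in M. f x * real_cond_exp M F g x = k * f x"
      using cond by eventually_elim simp
  qed auto
  finally show "(\<integral>x. f x * g x \<partial>M) = k * (\<integral>x. f x \<partial>M)" by simp
qed

locale sphere_sample = mu: sphere_uniform r \<mu> + prob_space M
  for r :: real and \<mu> :: "(real^'n) measure" and M :: "'w measure" +
  fixes X :: "'w \<Rightarrow> 'm::finite \<Rightarrow> real^'n" and \<rho> :: real
  assumes iid: "indep_vars (\<lambda>_. borel) (\<lambda>i \<omega>. X \<omega> i) UNIV"
    and law: "\<And>i. distr M borel (\<lambda>\<omega>. X \<omega> i) = \<mu>"
    and rho_pos: "\<rho> > 0"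
begin

lemma measurable_sample [measurable]: "(\<lambda>\<omega>. X \<omega> i) \<in> borel_measurable M"
  using iid by (simp add: indep_vars_def)

lemma integral_sample: "h \<in> borel_measurable borel \<Longrightarrow> (\<integral>\<omega>. h (X \<omega> i) \<partial>M) = (\<integral>x. h x \<partial>\<mu>)"
  for h :: "real^'n \<Rightarrow> real"
  using integral_distr[OF measurable_sample, of h i] by (simp add: law)

lemma AE_norm_sample: "AE \<omega> in M. \<forall>i. norm (X \<omega> i) = r"
proof -
  have "AE \<omega> in M. norm (X \<omega> i) = r" for i
    using mu.AE_norm unfolding law[of i, symmetric]
    by (subst (asm) AE_distr_iff) auto
  then show ?thesis by (simp add: AE_all_countable)
qed

lemma integrable_sample_inner_square: "integrable M (\<lambda>\<omega>. (p \<bullet> X \<omega> i)\<^sup>2)"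
  using integrable_distr[OF measurable_sample, of i "\<lambda>x. (p \<bullet> x)\<^sup>2"] mu.integrable_inner_square[of p]
  by (simp add: law)

text \<open>By independence the joint law is a product, and each factor is rotation invariant.
  Equality of joint laws is needed because the ridge operator depends on all inputs at once.\<close>

lemma distr_sample_rotate:
  assumes Q: "orthogonal_matrix Q"
  shows "distr M (\<Pi>\<^sub>M i\<in>UNIV. borel) (\<lambda>\<omega> i. Q *v X \<omega> i) = distr M (\<Pi>\<^sub>M i\<in>UNIV. borel) X"
proof -
  have Qm [measurable]: "(\<lambda>x. Q *v x) \<in> borel_measurable borel"
    by (intro borel_measurable_continuous_onI continuous_intros)
  have "indep_vars (\<lambda>_. borel) (\<lambda>i \<omega>. Q *v X \<omega> i) UNIV"
    by (rule indep_vars_compose2[OF iid]) simp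
  then have "distr M (\<Pi>\<^sub>M i\<in>UNIV. borel) (\<lambda>\<omega> i. Q *v X \<omega> i) = (\<Pi>\<^sub>M i\<in>UNIV. distr M borel (\<lambda>\<omega>. Q *v X \<omega> i))"
    by (subst (asm) indep_vars_iff_distr_eq_PiM') (simp_all add: restrict_UNIV)
  also have "(\<lambda>i. distr M borel (\<lambda>\<omega>. Q *v X \<omega> i)) = (\<lambda>i. distr M borel (\<lambda>\<omega>. X \<omega> i))"
  proof
    fix i
    have "distr M borel (\<lambda>\<omega>. Q *v X \<omega> i) = distr (distr M borel (\<lambda>\<omega>. X \<omega> i)) borel (\<lambda>x. Q *v x)"
      by (subst distr_distr) (simp_all add: comp_def)
    also have "\<dots> = distr M borel (\<lambda>\<omega>. X \<omega> i)"
      using mu.uniform Q by (simp add: law uniform_sphere_def)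
    finally show "distr M borel (\<lambda>\<omega>. Q *v X \<omega> i) = distr M borel (\<lambda>\<omega>. X \<omega> i)" .
  qed
  also have "(\<Pi>\<^sub>M i\<in>UNIV. distr M borel (\<lambda>\<omega>. X \<omega> i)) = distr M (\<Pi>\<^sub>M i\<in>UNIV. borel) X"
    using iid by (subst (asm) indep_vars_iff_distr_eq_PiM') (simp_all add: restrict_UNIV)
  finally show ?thesis .
qed

section \<open>Second moments of the ridge operator\<close>

abbreviation hat :: "'w \<Rightarrow> real^'n^'n" where "hat \<omega> \<equiv> ridge_op (X \<omega>) \<rho>"

lemma measurable_hat [measurable]: "(\<lambda>\<omega>. u \<bullet> (hat \<omega> *v v)) \<in> borel_measurable M"
  by (rule borel_measurable_ridge_op[OF measurable_sample rho_pos])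

lemma abs_inner_hat_le: "\<bar>u \<bullet> (hat \<omega> *v v)\<bar> \<le> norm u * norm v"
  using Cauchy_Schwarz_ineq2[of u "hat \<omega> *v v"] norm_ridge_op_le[OF rho_pos, of "X \<omega>" v]
  by (meson mult_left_mono norm_ge_zero order_trans)

lemma integrable_inner_hat_mult: "integrable M (\<lambda>\<omega>. (u \<bullet> (hat \<omega> *v v)) * (u' \<bullet> (hat \<omega> *v v')))"
proof (rule integrable_const_bound)
  show "AE \<omega> in M. norm ((u \<bullet> (hat \<omega> *v v)) * (u' \<bullet> (hat \<omega> *v v'))) \<le> norm u * norm v * (norm u' * norm v')"
    by (intro AE_I2) (simp add: abs_mult mult_mono abs_inner_hat_le)
qed measurable

lemma integrable_inner_hat_square: "integrable M (\<lambda>\<omega>. (u \<bullet> (hat \<omega> *v v))\<^sup>2)"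
  using integrable_inner_hat_mult[of u v u v] by (simp add: power2_eq_square)

text \<open>Replacing the sample by its rotated copy preserves the integral, and equivariance of the
  ridge operator then cancels \<open>Q\<close> in the integrand.\<close>

lemma inner_hat_square_rotate:
  assumes Q: "orthogonal_matrix Q"
  shows "(\<integral>\<omega>. ((Q *v u) \<bullet> (hat \<omega> *v (Q *v v)))\<^sup>2 \<partial>M) = (\<integral>\<omega>. (u \<bullet> (hat \<omega> *v v))\<^sup>2 \<partial>M)"
proof -
  let ?P = "\<Pi>\<^sub>M i\<in>(UNIV::'m set). (borel :: (real^'n) measure)"
  let ?h = "\<lambda>Y :: 'm \<Rightarrow> real^'n. ((Q *v u) \<bullet> (ridge_op Y \<rho> *v (Q *v v)))\<^sup>2"
  have "(\<lambda>Y. (Q *v u) \<bullet> (ridge_op Y \<rho> *v (Q *v v))) \<in> borel_measurable ?P"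
    by (rule borel_measurable_ridge_op[OF _ rho_pos]) simp
  then have h: "?h \<in> borel_measurable ?P" by simp
  have X: "X \<in> measurable M ?P"
    using measurable_PiM_single'[of UNIV "\<lambda>i \<omega>. X \<omega> i" M "\<lambda>_. borel"] by simp
  have [measurable]: "(\<lambda>x. Q *v x) \<in> borel_measurable borel"
    by (intro borel_measurable_continuous_onI continuous_intros)
  have QX: "(\<lambda>\<omega> i. Q *v X \<omega> i) \<in> measurable M ?P"
    using measurable_PiM_single'[of UNIV "\<lambda>i \<omega>. Q *v X \<omega> i" M "\<lambda>_. borel"] by simp
  have "(\<integral>\<omega>. ?h (X \<omega>) \<partial>M) = (\<integral>Y. ?h Y \<partial>distr M ?P X)"
    by (rule integral_distr[symmetric, OF X h])
  also have "\<dots> = (\<integral>\<omega>. ?h (\<lambda>i. Q *v X \<omega> i) \<partial>M)"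
    unfolding distr_sample_rotate[OF Q, symmetric] by (rule integral_distr[OF QX h])
  finally show ?thesis by (simp add: inner_ridge_op_rotate[OF Q])
qed

text \<open>The common value of the second moments of \<open>u \<bullet> (hat \<omega> *v v)\<close> over all orthonormal pairs
 \<open>u\<close>, \<open>v\<close>, written in terms of traces.\<close>

definition cross_moment :: real where
  "cross_moment = (real CARD('n) * (\<integral>\<omega>. trace (hat \<omega> ** hat \<omega>) \<partial>M) - (\<integral>\<omega>. (trace (hat \<omega>))\<^sup>2 \<partial>M))
     / (real CARD('n) * (real CARD('n) + 2) * (real CARD('n) - 1))"

text \<open>By rotation invariance the second moment is the same number \<open>\<beta>\<close> for all orthonormal pairs.
 The pairs of coordinate vectors give the off-diagonal entries, and the pairs proportional to
 \<open>axis i 1 + axis j 1\<close>, \<open>axis i 1 - axis j 1\<close> give the differences of diagonal entries; these are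
 exactly the terms of the trace identity.\<close>

lemma integral_inner_hat_square:
  assumes d: "CARD('n) > 1" and uv: "u \<bullet> v = 0"
  shows "(\<integral>\<omega>. (u \<bullet> (hat \<omega> *v v))\<^sup>2 \<partial>M) = (norm u)\<^sup>2 * (norm v)\<^sup>2 * cross_moment"
proof -
  let ?d = "real CARD('n)"
  define b where "b u v = (\<integral>\<omega>. (u \<bullet> (hat \<omega> *v v))\<^sup>2 \<partial>M)" for u v
  obtain k l :: 'n where kl: "k \<noteq> l" using ex_distinct_of_card[OF d] by blast
  define \<beta> where "\<beta> = b (axis k 1) (axis l 1)"
  have unit: "b u v = \<beta>" if orthonormal: "norm u = 1" "norm v = 1" "u \<bullet> v = 0" for u v
  proof -
    obtain Q where "orthogonal_matrix Q" "Q *v axis k 1 = u" "Q *v axis l 1 = v"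
      by (rule orthogonal_matrix_maps_orthonormal_pair[of "axis k 1" "axis l 1" u v])
         (use orthonormal kl in \<open>auto simp: inner_axis_axis\<close>)
    then show ?thesis
      using inner_hat_square_rotate[of Q "axis k 1" "axis l 1"] by (simp add: b_def \<beta>_def)
  qed
  have general: "b u v = (norm u)\<^sup>2 * (norm v)\<^sup>2 * \<beta>" if "u \<bullet> v = 0" for u v
  proof (cases "u = 0 \<or> v = 0")
    case True
    then show ?thesis by (auto simp: b_def)
  next
    case False
    have "b u v = (\<integral>\<omega>. ((norm u)\<^sup>2 * (norm v)\<^sup>2) * ((u /\<^sub>R norm u) \<bullet> (hat \<omega> *v (v /\<^sub>R norm v)))\<^sup>2 \<partial>M)"
      unfolding b_def
      by (intro Bochner_Integration.integral_cong refl)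
        (use False in \<open>simp add: matrix_vector_mult_scaleR power_mult_distrib divide_simps\<close>)
    also have "\<dots> = (norm u)\<^sup>2 * (norm v)\<^sup>2 * b (u /\<^sub>R norm u) (v /\<^sub>R norm v)"
      by (simp add: b_def)
    also have "b (u /\<^sub>R norm u) (v /\<^sub>R norm v) = \<beta>"
      by (rule unit) (use False that in auto)
    finally show ?thesis .
  qed
  have entry: "hat \<omega> $ i $ j = axis i 1 \<bullet> (hat \<omega> *v axis j 1)" for \<omega> i j
    by (simp add: inner_axis' matrix_vector_mult_basis column_def)
  have off: "(\<integral>\<omega>. (hat \<omega> $ i $ j)\<^sup>2 \<partial>M) = \<beta>" if "i \<noteq> j" for i j
    using unit[of "axis i 1" "axis j 1"] that by (simp add: entry b_def inner_axis_axis)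
  have diag: "(\<integral>\<omega>. (hat \<omega> $ i $ i - hat \<omega> $ j $ j)\<^sup>2 \<partial>M) = 4 * \<beta>" if "i \<noteq> j" for i j
  proof -
    let ?u = "axis i 1 + axis j 1 :: real^'n" and ?v = "axis i 1 - axis j 1 :: real^'n"
    have nu: "(norm ?u)\<^sup>2 = 2" "(norm ?v)\<^sup>2 = 2"
      using that by (simp_all add: power2_norm_eq_inner inner_add inner_diff inner_axis_axis)
    have uv0: "?u \<bullet> ?v = 0"
      using that by (simp add: inner_add inner_diff inner_axis_axis)
    \<comment> \<open>The mixed entries cancel because the ridge operator is symmetric. The two
      vectors are orthogonal with squared length 2, whence the factor 4.\<close>
    have "?u \<bullet> (hat \<omega> *v ?v) = hat \<omega> $ i $ i - hat \<omega> $ j $ j" for \<omega>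
    proof -
      have "hat \<omega> $ i $ j = hat \<omega> $ j $ i"
        using arg_cong[OF transpose_ridge_op[OF rho_pos, of "X \<omega>"], of "\<lambda>A. A $ j $ i"]
        by (simp add: transpose_def)
      then show ?thesis
        by (simp add: matrix_vector_mult_diff_distrib inner_add inner_diff entry)
    qed
    then show ?thesis using general[OF uv0] unfolding nu b_def by simp
  qed
  have int_diag: "integrable M (\<lambda>\<omega>. (hat \<omega> $ i $ i - hat \<omega> $ j $ j)\<^sup>2)" for i j
    unfolding entry power2_diff
    by (intro Bochner_Integration.integrable_diff Bochner_Integration.integrable_add integrable_inner_hat_square)
       (simp add: mult.assoc integrable_inner_hat_mult)
  have int_off: "integrable M (\<lambda>\<omega>. (hat \<omega> $ i $ j)\<^sup>2)" for i j
    unfolding entry by (rule integrable_inner_hat_square)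
  have tr: "trace (hat \<omega>) = (\<Sum>i\<in>UNIV. axis i 1 \<bullet> (hat \<omega> *v axis i 1))" for \<omega>
    by (simp add: trace_def entry)
  have int_tr2: "integrable M (\<lambda>\<omega>. (trace (hat \<omega>))\<^sup>2)"
    unfolding tr power2_eq_square sum_product
    by (intro Bochner_Integration.integrable_sum integrable_inner_hat_mult)
  have tr_sq: "trace (hat \<omega> ** hat \<omega>) = (\<Sum>i\<in>UNIV. \<Sum>j\<in>UNIV. hat \<omega> $ i $ j * hat \<omega> $ j $ i)" for \<omega>
    by (simp add: trace_def matrix_matrix_mult_def)
  have int_trsq: "integrable M (\<lambda>\<omega>. trace (hat \<omega> ** hat \<omega>))"
    unfolding tr_sq entry
    by (intro Bochner_Integration.integrable_sum integrable_inner_hat_mult)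
  have "?d * (\<integral>\<omega>. trace (hat \<omega> ** hat \<omega>) \<partial>M) - (\<integral>\<omega>. (trace (hat \<omega>))\<^sup>2 \<partial>M)
      = (\<integral>\<omega>. ?d * trace (hat \<omega> ** hat \<omega>) - (trace (hat \<omega>))\<^sup>2 \<partial>M)"
    using int_tr2 int_trsq by simp
  also have "\<dots> = (\<integral>\<omega>. (\<Sum>i\<in>UNIV. \<Sum>j\<in>UNIV. (hat \<omega> $ i $ i - hat \<omega> $ j $ j)\<^sup>2) / 2
      + ?d * (\<Sum>i\<in>UNIV. \<Sum>j\<in>UNIV - {i}. (hat \<omega> $ i $ j)\<^sup>2) \<partial>M)"
    by (simp only: trace_symmetric_square_identity[OF transpose_ridge_op[OF rho_pos]])
  also have "\<dots> = (\<Sum>i\<in>UNIV. \<Sum>j\<in>UNIV. (\<integral>\<omega>. (hat \<omega> $ i $ i - hat \<omega> $ j $ j)\<^sup>2 \<partial>M)) / 2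
      + ?d * (\<Sum>i\<in>UNIV. \<Sum>j\<in>UNIV - {i}. (\<integral>\<omega>. (hat \<omega> $ i $ j)\<^sup>2 \<partial>M))"
    using int_diag int_off by (simp add: Bochner_Integration.integral_sum)
  also have "(\<Sum>i\<in>UNIV. \<Sum>j\<in>UNIV. (\<integral>\<omega>. (hat \<omega> $ i $ i - hat \<omega> $ j $ j)\<^sup>2 \<partial>M))
      = (\<Sum>i\<in>(UNIV::'n set). \<Sum>j\<in>UNIV - {i}. 4 * \<beta>)"
  proof (rule sum.cong[OF refl])
    fix i :: 'n
    have "(\<Sum>j\<in>UNIV. (\<integral>\<omega>. (hat \<omega> $ i $ i - hat \<omega> $ j $ j)\<^sup>2 \<partial>M))
        = (\<Sum>j\<in>UNIV - {i}. (\<integral>\<omega>. (hat \<omega> $ i $ i - hat \<omega> $ j $ j)\<^sup>2 \<partial>M))"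
      by (subst sum.remove[of _ i]) simp_all
    also have "\<dots> = (\<Sum>j\<in>UNIV - {i}. 4 * \<beta>)" by (rule sum.cong) (auto simp: diag)
    finally show "(\<Sum>j\<in>UNIV. (\<integral>\<omega>. (hat \<omega> $ i $ i - hat \<omega> $ j $ j)\<^sup>2 \<partial>M)) = (\<Sum>j\<in>UNIV - {i}. 4 * \<beta>)" .
  qed
  also have "(\<Sum>i\<in>UNIV. \<Sum>j\<in>UNIV - {i}. (\<integral>\<omega>. (hat \<omega> $ i $ j)\<^sup>2 \<partial>M)) = (\<Sum>i\<in>(UNIV::'n set). \<Sum>j\<in>UNIV - {i}. \<beta>)"
    by (intro sum.cong refl off) auto
  \<comment> \<open>There are d(d-1) ordered pairs of distinct indices. The diagonal part gives 2
    d(d-1) \<beta> after halving and the off-diagonal part d times d(d-1) \<beta>, together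
    d(d+2)(d-1) \<beta>.\<close>
  finally have "?d * (\<integral>\<omega>. trace (hat \<omega> ** hat \<omega>) \<partial>M) - (\<integral>\<omega>. (trace (hat \<omega>))\<^sup>2 \<partial>M)
      = ?d * (?d + 2) * (?d - 1) * \<beta>"
    using d by (simp add: card_Diff_singleton of_nat_diff field_simps)
  then have "cross_moment = \<beta>" using d by (simp add: cross_moment_def)
  with general[OF uv] show ?thesis by (simp add: b_def)
qed

text \<open>It is itself a second moment, that of an off-diagonal entry; such an entry exists
  because the dimension exceeds 1.\<close>

lemma cross_moment_nonneg:
  assumes d: "CARD('n) > 1"
  shows "cross_moment \<ge> 0"
proof -
  obtain k l :: 'n where kl: "k \<noteq> l" using ex_distinct_of_card[OF d] by blast
  then have "(\<integral>\<omega>. (axis k 1 \<bullet> (hat \<omega> *v axis l 1))\<^sup>2 \<partial>M) = cross_moment"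
    using integral_inner_hat_square[OF d, of "axis k 1" "axis l 1"] by (simp add: inner_axis_axis)
  then show ?thesis by (metis integral_nonneg zero_le_power2 AE_I2 integral_nonneg_AE)
qed

section \<open>The coefficients with which the noise enters \<open>p \<bullet> w\<close> for the
  ridge weight \<open>w\<close>\<close>

abbreviation noise_coef :: "'w \<Rightarrow> real^'n \<Rightarrow> real^'m" where
  "noise_coef \<omega> p \<equiv> resolvent (X \<omega>) \<rho> *v (design (X \<omega>) *v p)"

lemma measurable_noise_coef [measurable]: "(\<lambda>\<omega>. noise_coef \<omega> p $ i) \<in> borel_measurable M"
  by (rule borel_measurable_resolvent_design_component[OF measurable_sample rho_pos])

lemma abs_noise_coef_le: "\<bar>noise_coef \<omega> p $ i\<bar> \<le> norm p / sqrt \<rho>"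
proof -
  have "norm (noise_coef \<omega> p) \<le> sqrt ((norm p)\<^sup>2 / \<rho>)"
    using norm_resolvent_design_le[OF rho_pos, of "X \<omega>" p] by (rule real_le_rsqrt)
  then show ?thesis
    using component_le_norm_cart[of "noise_coef \<omega> p" i] by (simp add: real_sqrt_divide)
qed

lemma integrable_noise_coef_square: "integrable M (\<lambda>\<omega>. (noise_coef \<omega> p $ i)\<^sup>2)"
proof (rule integrable_const_bound)
  show "AE \<omega> in M. norm ((noise_coef \<omega> p $ i)\<^sup>2) \<le> (norm p / sqrt \<rho>)\<^sup>2"
    using abs_noise_coef_le by (intro AE_I2) (metis abs_ge_zero norm_power power_mono real_norm_def)
qed measurable

text \<open>Apply the lower bound on the resolvent to \<open>X p\<close> for almost every sample,
  then take expectations: each input contributes the second moment of \<open>p \<bullet> x\<close>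
  on the sphere.\<close>

lemma integral_norm_noise_coef_ge:
  "real CARD('m) * ((norm p)\<^sup>2 * r\<^sup>2 / real CARD('n)) / (real CARD('m) * r\<^sup>2 + \<rho>)\<^sup>2
    \<le> (\<integral>\<omega>. (norm (noise_coef \<omega> p))\<^sup>2 \<partial>M)"
proof -
  let ?c = "(real CARD('m) * r\<^sup>2 + \<rho>)\<^sup>2"
  have "(\<integral>\<omega>. (p \<bullet> X \<omega> i)\<^sup>2 \<partial>M) = (norm p)\<^sup>2 * r\<^sup>2 / real CARD('n)" for i
    using integral_sample[of "\<lambda>x. (p \<bullet> x)\<^sup>2" i] by (simp add: mu.integral_inner_square)
  then have "real CARD('m) * ((norm p)\<^sup>2 * r\<^sup>2 / real CARD('n)) / ?c
      = (\<integral>\<omega>. (\<Sum>i\<in>UNIV. (p \<bullet> X \<omega> i)\<^sup>2) / ?c \<partial>M)"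
    by (simp add: Bochner_Integration.integral_sum integrable_sample_inner_square)
  also have "\<dots> \<le> (\<integral>\<omega>. (norm (noise_coef \<omega> p))\<^sup>2 \<partial>M)"
  proof (rule integral_mono_AE)
    show "integrable M (\<lambda>\<omega>. (\<Sum>i\<in>UNIV. (p \<bullet> X \<omega> i)\<^sup>2) / ?c)"
      by (intro Bochner_Integration.integrable_divide_zero Bochner_Integration.integrable_sum integrable_sample_inner_square)
    have "(norm (noise_coef \<omega> p))\<^sup>2 = (\<Sum>i\<in>UNIV. (noise_coef \<omega> p $ i)\<^sup>2)" for \<omega>
      unfolding power2_norm_eq_inner inner_vec_def[of "noise_coef \<omega> p"] by (simp add: power2_eq_square)
    then show "integrable M (\<lambda>\<omega>. (norm (noise_coef \<omega> p))\<^sup>2)"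
      by (simp add: integrable_noise_coef_square)
    show "AE \<omega> in M. (\<Sum>i\<in>UNIV. (p \<bullet> X \<omega> i)\<^sup>2) / ?c \<le> (norm (noise_coef \<omega> p))\<^sup>2"
      using AE_norm_sample
    proof eventually_elim
      fix \<omega> assume "\<forall>i. norm (X \<omega> i) = r"
      then have "(norm (design (X \<omega>) *v p))\<^sup>2 / ?c \<le> (norm (noise_coef \<omega> p))\<^sup>2"
        by (intro norm_resolvent_ge[OF rho_pos]) auto
      then show "(\<Sum>i\<in>UNIV. (p \<bullet> X \<omega> i)\<^sup>2) / ?c \<le> (norm (noise_coef \<omega> p))\<^sup>2"
        by (simp add: norm_design_mult inner_commute)
    qed
  qed
  finally show ?thesis .
qed

section \<open>Conditioning on the sampled inputs\<close>

definition sample_algebra :: "'w measure" where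
  "sample_algebra = sigma (space M) (\<Union>i. {(\<lambda>\<omega>. X \<omega> i) -` A \<inter> space M | A. A \<in> sets borel})"

lemma space_sample_algebra: "space sample_algebra = space M"
  by (simp add: sample_algebra_def space_measure_of_conv)

lemma sets_sample_algebra:
  "sets sample_algebra = sigma_sets (space M) (\<Union>i. {(\<lambda>\<omega>. X \<omega> i) -` A \<inter> space M | A. A \<in> sets borel})"
  unfolding sample_algebra_def by (rule sets_measure_of) auto

lemma subalgebra_sample_algebra: "subalgebra M sample_algebra"
  unfolding subalgebra_def space_sample_algebra sets_sample_algebra
  by (auto intro!: sets.sigma_sets_subset measurable_sets[OF measurable_sample])

lemma measurable_sample_algebra: "(\<lambda>\<omega>. X \<omega> i) \<in> borel_measurable sample_algebra"
  by (rule measurableI) (auto simp: space_sample_algebra sets_sample_algebra intro!: sigma_sets.Basic)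

sublocale finite_measure_subalgebra M sample_algebra
  by unfold_locales (rule subalgebra_sample_algebra)

end

locale noisy_sphere_sample = sphere_sample r \<mu> M X \<rho>
  for r :: real and \<mu> :: "(real^'n) measure" and M :: "'w measure"
    and X :: "'w \<Rightarrow> 'm::finite \<Rightarrow> real^'n" and \<rho> :: real +
  fixes \<xi> :: "'w \<Rightarrow> 'm \<Rightarrow> real"
  assumes noise_mean: "\<And>i. integrable M (\<lambda>\<omega>. \<xi> \<omega> i)"
      "\<And>i. AE \<omega> in M. real_cond_exp M sample_algebra (\<lambda>\<omega>. \<xi> \<omega> i) \<omega> = 0"
    and noise_cov: "\<And>i j. integrable M (\<lambda>\<omega>. \<xi> \<omega> i * \<xi> \<omega> j)"
      "\<And>i j. AE \<omega> in M. real_cond_exp M sample_algebra (\<lambda>\<omega>. \<xi> \<omega> i * \<xi> \<omega> j) \<omega> = (if i = j then 1 else 0)"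
begin

abbreviation weight :: "'w \<Rightarrow> real^'n \<Rightarrow> real^'n" where
  "weight \<omega> \<theta> \<equiv> hat \<omega> *v \<theta> + transpose (design (X \<omega>)) *v (resolvent (X \<omega>) \<rho> *v (\<chi> i. \<xi> \<omega> i))"

lemma inner_weight: "p \<bullet> weight \<omega> \<theta> = p \<bullet> (hat \<omega> *v \<theta>) + (\<Sum>i\<in>UNIV. noise_coef \<omega> p $ i * \<xi> \<omega> i)"
proof -
  have "p \<bullet> (transpose (design (X \<omega>)) *v (resolvent (X \<omega>) \<rho> *v (\<chi> i. \<xi> \<omega> i)))
      = (resolvent (X \<omega>) \<rho> *v (\<chi> i. \<xi> \<omega> i)) \<bullet> (design (X \<omega>) *v p)"
    by (simp only: inner_design inner_commute[of p])
  also have "\<dots> = noise_coef \<omega> p \<bullet> (\<chi> i. \<xi> \<omega> i)"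
    using inner_matrix_vector_mult[of "design (X \<omega>) *v p" "resolvent (X \<omega>) \<rho>" "\<chi> i. \<xi> \<omega> i"]
    by (simp only: transpose_resolvent[OF rho_pos] inner_commute)
  finally show ?thesis
    by (simp add: inner_add_right inner_vec_def[of "noise_coef \<omega> p"])
qed

text \<open>After squaring \<open>inner_weight\<close>, every factor multiplying the noise is
  bounded and determined by the inputs. Conditionally the terms linear in the noise average to zero,
  and of the quadratic ones only the diagonal survives.\<close>

lemma
  shows integrable_inner_weight_square: "integrable M (\<lambda>\<omega>. (p \<bullet> weight \<omega> \<theta>)\<^sup>2)"
    and integral_inner_weight_square: "(\<integral>\<omega>. (p \<bullet> weight \<omega> \<theta>)\<^sup>2 \<partial>M)
      = (\<integral>\<omega>. (p \<bullet> (hat \<omega> *v \<theta>))\<^sup>2 \<partial>M) + (\<integral>\<omega>. (norm (noise_coef \<omega> p))\<^sup>2 \<partial>M)"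
proof -
  let ?a = "\<lambda>\<omega>. p \<bullet> (hat \<omega> *v \<theta>)" and ?c = "\<lambda>\<omega> i. noise_coef \<omega> p $ i"
  have a_meas: "?a \<in> borel_measurable sample_algebra"
    by (rule borel_measurable_ridge_op[OF measurable_sample_algebra rho_pos])
  have c_meas: "(\<lambda>\<omega>. ?c \<omega> i) \<in> borel_measurable sample_algebra" for i
    by (rule borel_measurable_resolvent_design_component[OF measurable_sample_algebra rho_pos])
  have expand: "(p \<bullet> weight \<omega> \<theta>)\<^sup>2 = (?a \<omega>)\<^sup>2 + (2 * (\<Sum>i\<in>UNIV. (?a \<omega> * ?c \<omega> i) * \<xi> \<omega> i)
      + (\<Sum>i\<in>UNIV. \<Sum>j\<in>UNIV. (?c \<omega> i * ?c \<omega> j) * (\<xi> \<omega> i * \<xi> \<omega> j)))" for \<omega>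
    unfolding inner_weight power2_sum
    by (simp add: power2_eq_square[of "sum _ _"] sum_product sum_distrib_left mult_ac)
  have lin: "integrable M (\<lambda>\<omega>. (?a \<omega> * ?c \<omega> i) * \<xi> \<omega> i)" "(\<integral>\<omega>. (?a \<omega> * ?c \<omega> i) * \<xi> \<omega> i \<partial>M) = 0" for i
  proof -
    have "AE \<omega> in M. \<bar>?a \<omega> * ?c \<omega> i\<bar> \<le> norm p * norm \<theta> * (norm p / sqrt \<rho>)"
      by (intro AE_I2) (simp only: abs_mult, intro mult_mono abs_inner_hat_le abs_noise_coef_le, auto)
    from integral_mult_cond_exp_const[OF borel_measurable_times[OF a_meas c_meas] this noise_mean]
    show "integrable M (\<lambda>\<omega>. (?a \<omega> * ?c \<omega> i) * \<xi> \<omega> i)" "(\<integral>\<omega>. (?a \<omega> * ?c \<omega> i) * \<xi> \<omega> i \<partial>M) = 0"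
      by simp_all
  qed
  have quad: "integrable M (\<lambda>\<omega>. (?c \<omega> i * ?c \<omega> j) * (\<xi> \<omega> i * \<xi> \<omega> j))"
    "(\<integral>\<omega>. (?c \<omega> i * ?c \<omega> j) * (\<xi> \<omega> i * \<xi> \<omega> j) \<partial>M) = (if i = j then (\<integral>\<omega>. (?c \<omega> i)\<^sup>2 \<partial>M) else 0)" for i j
  proof -
    have "AE \<omega> in M. \<bar>?c \<omega> i * ?c \<omega> j\<bar> \<le> norm p / sqrt \<rho> * (norm p / sqrt \<rho>)"
      using rho_pos by (intro AE_I2) (simp only: abs_mult, intro mult_mono abs_noise_coef_le, auto)
    from integral_mult_cond_exp_const[OF borel_measurable_times[OF c_meas c_meas] this noise_cov]
    show "integrable M (\<lambda>\<omega>. (?c \<omega> i * ?c \<omega> j) * (\<xi> \<omega> i * \<xi> \<omega> j))"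
      "(\<integral>\<omega>. (?c \<omega> i * ?c \<omega> j) * (\<xi> \<omega> i * \<xi> \<omega> j) \<partial>M) = (if i = j then (\<integral>\<omega>. (?c \<omega> i)\<^sup>2 \<partial>M) else 0)"
      by (simp_all add: power2_eq_square)
  qed
  have int_rest: "integrable M (\<lambda>\<omega>. 2 * (\<Sum>i\<in>UNIV. (?a \<omega> * ?c \<omega> i) * \<xi> \<omega> i)
      + (\<Sum>i\<in>UNIV. \<Sum>j\<in>UNIV. (?c \<omega> i * ?c \<omega> j) * (\<xi> \<omega> i * \<xi> \<omega> j)))"
    by (intro Bochner_Integration.integrable_add Bochner_Integration.integrable_mult_right
        Bochner_Integration.integrable_sum lin quad)
  show "integrable M (\<lambda>\<omega>. (p \<bullet> weight \<omega> \<theta>)\<^sup>2)"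
    unfolding expand by (intro Bochner_Integration.integrable_add integrable_inner_hat_square int_rest)
  have "(\<integral>\<omega>. (norm (noise_coef \<omega> p))\<^sup>2 \<partial>M) = (\<integral>\<omega>. (\<Sum>i\<in>UNIV. (?c \<omega> i)\<^sup>2) \<partial>M)"
    unfolding power2_norm_eq_inner inner_vec_def[of "noise_coef _ p"] by (simp add: power2_eq_square)
  also have "\<dots> = (\<Sum>i\<in>UNIV. (\<integral>\<omega>. (?c \<omega> i)\<^sup>2 \<partial>M))"
    by (rule Bochner_Integration.integral_sum) (rule integrable_noise_coef_square)
  finally have coef: "(\<integral>\<omega>. (norm (noise_coef \<omega> p))\<^sup>2 \<partial>M) = (\<Sum>i\<in>UNIV. (\<integral>\<omega>. (?c \<omega> i)\<^sup>2 \<partial>M))" .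
  have "(\<integral>\<omega>. (\<Sum>i\<in>UNIV. (?a \<omega> * ?c \<omega> i) * \<xi> \<omega> i) \<partial>M) = 0"
    by (subst Bochner_Integration.integral_sum) (simp_all only: lin sum.neutral_const)
  moreover have "(\<integral>\<omega>. (\<Sum>i\<in>UNIV. \<Sum>j\<in>UNIV. (?c \<omega> i * ?c \<omega> j) * (\<xi> \<omega> i * \<xi> \<omega> j)) \<partial>M)
      = (\<Sum>i\<in>UNIV. \<Sum>j\<in>UNIV. (\<integral>\<omega>. (?c \<omega> i * ?c \<omega> j) * (\<xi> \<omega> i * \<xi> \<omega> j) \<partial>M))"
    using quad(1) by (simp add: Bochner_Integration.integral_sum)
  moreover have "\<dots> = (\<integral>\<omega>. (norm (noise_coef \<omega> p))\<^sup>2 \<partial>M)"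
    unfolding quad(2) coef by simp
  ultimately have "(\<integral>\<omega>. 2 * (\<Sum>i\<in>UNIV. (?a \<omega> * ?c \<omega> i) * \<xi> \<omega> i)
      + (\<Sum>i\<in>UNIV. \<Sum>j\<in>UNIV. (?c \<omega> i * ?c \<omega> j) * (\<xi> \<omega> i * \<xi> \<omega> j)) \<partial>M) = (\<integral>\<omega>. (norm (noise_coef \<omega> p))\<^sup>2 \<partial>M)"
    by (subst Bochner_Integration.integral_add)
       (auto intro!: Bochner_Integration.integrable_sum lin quad)
  then show "(\<integral>\<omega>. (p \<bullet> weight \<omega> \<theta>)\<^sup>2 \<partial>M)
      = (\<integral>\<omega>. (p \<bullet> (hat \<omega> *v \<theta>))\<^sup>2 \<partial>M) + (\<integral>\<omega>. (norm (noise_coef \<omega> p))\<^sup>2 \<partial>M)"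
    unfolding expand
    by (subst Bochner_Integration.integral_add[OF integrable_inner_hat_square int_rest]) simp
qed

end

section \<open>Excess risk\<close>

text \<open>The prediction error is \<open>(w - \<theta>) \<bullet> X - \<xi>\<close>. The cross
  term has mean zero, leaving the second moment on the sphere and the unit noise variance.\<close>

lemma risk_linear_predictor:
  fixes \<mu> :: "(real^'n) measure"
  assumes unif: "uniform_sphere r \<mu>" and N: "prob_space N" and law: "distr N borel X = \<mu>"
    and mean: "integrable N \<xi>" "AE v in N. real_cond_exp N (vimage_algebra (space N) X borel) \<xi> v = 0"
    and var: "integrable N (\<lambda>v. (\<xi> v)\<^sup>2)" "(\<integral>v. (\<xi> v)\<^sup>2 \<partial>N) = 1"
  shows "risk N X (\<lambda>v. \<theta> \<bullet> X v + \<xi> v) (\<lambda>x. w \<bullet> x) = (norm (w - \<theta>))\<^sup>2 * r\<^sup>2 / real CARD('n) + 1"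
proof -
  interpret mu: sphere_uniform r \<mu> by unfold_locales (rule unif)
  interpret N: prob_space N by (rule N)
  \<comment> \<open>Measurability of the test input is read off from its law being a probability
    measure.\<close>
  have X [measurable]: "X \<in> borel_measurable N"
    by (rule prob_space_distr_imp_measurable) (simp_all add: law mu.prob_space_axioms)
  let ?F = "vimage_algebra (space N) X borel"
  have "subalgebra N ?F"
    by (auto simp: subalgebra_def sets_vimage_algebra2)
  then interpret F: finite_measure_subalgebra N ?F by unfold_locales
  let ?u = "w - \<theta>"
  have XF: "X \<in> borel_measurable ?F" by (rule measurable_vimage_algebra1) simp
  have AE_norm: "AE v in N. norm (X v) = r"
    using mu.AE_norm unfolding law[symmetric] by (subst (asm) AE_distr_iff) auto
  have "AE v in N. \<bar>?u \<bullet> X v\<bar> \<le> norm ?u * r"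
    using AE_norm by eventually_elim (metis Cauchy_Schwarz_ineq2)
  moreover have "(\<lambda>v. ?u \<bullet> X v) \<in> borel_measurable ?F" using XF by measurable
  ultimately have cross: "integrable N (\<lambda>v. (?u \<bullet> X v) * \<xi> v)" "(\<integral>v. (?u \<bullet> X v) * \<xi> v \<partial>N) = 0"
    using F.integral_mult_cond_exp_const[of "\<lambda>v. ?u \<bullet> X v" "norm ?u * r" \<xi> 0] mean by auto
  have sq: "integrable N (\<lambda>v. (?u \<bullet> X v)\<^sup>2)"
    using integrable_distr[OF X, of "\<lambda>x. (?u \<bullet> x)\<^sup>2"] mu.integrable_inner_square[of ?u] by (simp add: law)
  have "(\<integral>v. (?u \<bullet> X v)\<^sup>2 \<partial>N) = (norm ?u)\<^sup>2 * r\<^sup>2 / real CARD('n)"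
    using integral_distr[OF X, of "\<lambda>x. (?u \<bullet> x)\<^sup>2"] mu.integral_inner_square[of ?u] by (simp add: law)
  moreover have "risk N X (\<lambda>v. \<theta> \<bullet> X v + \<xi> v) (\<lambda>x. w \<bullet> x)
      = (\<integral>v. (?u \<bullet> X v)\<^sup>2 - 2 * ((?u \<bullet> X v) * \<xi> v) + (\<xi> v)\<^sup>2 \<partial>N)"
    unfolding risk_def
    by (intro Bochner_Integration.integral_cong refl) (simp add: inner_diff_left power2_eq_square algebra_simps)
  ultimately show ?thesis using cross sq var by simp
qed

section \<open>Assembly of the excess risk bound and the exact values of its two terms\<close>

theorem theorem5p12:
  fixes gmul :: "'g::{t2_space,second_countable_topology} \<Rightarrow> 'g \<Rightarrow> 'g"
    and e :: 'g and ginv :: "'g \<Rightarrow> 'g" and lam :: "'g measure"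
    and \<phi> :: "'g \<Rightarrow> real^'n^'n"
    and \<mu> :: "(real^'n) measure"
    and \<theta> :: "real^'n"
    and M :: "'w measure" and Xs :: "'w \<Rightarrow> 'm::finite \<Rightarrow> real^'n" and \<xi>s :: "'w \<Rightarrow> 'm \<Rightarrow> real"
    and N :: "'v measure" and Xt :: "'v \<Rightarrow> real^'n" and \<xi>t :: "'v \<Rightarrow> real"
    and \<rho> :: real
    and \<gamma> :: "'w \<Rightarrow> 'm \<Rightarrow> real"
    and f' :: "'w \<Rightarrow> real^'n \<Rightarrow> real"
  defines "d \<equiv> real CARD('n)"
    and "n \<equiv> real CARD('m)"
    and "fstar \<equiv> (\<lambda>x::real^'n. \<theta> \<bullet> x)"
    and "\<Phi> \<equiv> integral\<^sup>L lam \<phi>"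
    and "Yt \<equiv> (\<lambda>v. \<theta> \<bullet> Xt v + \<xi>t v)"
    and "F \<equiv> sigma (space M) (\<Union>i. {(\<lambda>\<omega>. Xs \<omega> i) -` A \<inter> space M | A. A \<in> sets borel})"
    and "f \<equiv> (\<lambda>\<omega>. krr (Xs \<omega>) (\<lambda>i. \<theta> \<bullet> Xs \<omega> i + \<xi>s \<omega> i) \<rho>)"
    and "R \<equiv> risk N Xt (\<lambda>v. \<theta> \<bullet> Xt v + \<xi>t v)"
    and "\<zeta>1 \<equiv> (\<integral>\<omega>. (\<Sum>i\<in>UNIV. (\<gamma> \<omega> i)^2 / (\<gamma> \<omega> i + \<rho>)^2) \<partial>M)"
    and "\<zeta>2 \<equiv> (\<integral>\<omega>. (\<Sum>i\<in>UNIV. \<gamma> \<omega> i / (\<gamma> \<omega> i + \<rho>))^2 \<partial>M)"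
    and "Mk \<equiv> Sup ((\<lambda>x::real^'n. lin_kernel x x) ` sphere 0 (sqrt (real CARD('n))))"
  assumes d_gt1: "CARD('n) > 1"
    and group: "haar_compact_group gmul e ginv lam"
    and rep: "orth_rep gmul lam \<phi>"
    and unif: "uniform_sphere (sqrt d) \<mu>"
    and inv: "\<forall>g. \<forall>x\<in>sphere 0 (sqrt d). fstar (\<phi> g *v x) = fstar x"
    and M: "prob_space M"
    and iid: "prob_space.indep_vars M (\<lambda>_. borel) (\<lambda>i \<omega>. Xs \<omega> i) UNIV"
    and Xs_law: "\<forall>i. distr M borel (\<lambda>\<omega>. Xs \<omega> i) = \<mu>"
    and \<xi>s_meas: "\<forall>i. (\<lambda>\<omega>. \<xi>s \<omega> i) \<in> borel_measurable M"
    and \<xi>s_mean: "\<forall>i. integrable M (\<lambda>\<omega>. \<xi>s \<omega> i) \<and>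
                    (AE \<omega> in M. real_cond_exp M F (\<lambda>\<omega>. \<xi>s \<omega> i) \<omega> = 0)"
    and \<xi>s_cov: "\<forall>i j. integrable M (\<lambda>\<omega>. \<xi>s \<omega> i * \<xi>s \<omega> j) \<and>
                    (AE \<omega> in M. real_cond_exp M F (\<lambda>\<omega>. \<xi>s \<omega> i * \<xi>s \<omega> j) \<omega>
                                = (if i = j then 1 else 0))"
    and N: "prob_space N"
    and Xt_law: "distr N borel Xt = \<mu>"
    and \<xi>t_meas: "\<xi>t \<in> borel_measurable N"
    and \<xi>t_mean: "integrable N \<xi>t \<and>
                  (AE v in N. real_cond_exp N (vimage_algebra (space N) Xt borel) \<xi>t v = 0)"
    and \<xi>t_var: "integrable N (\<lambda>v. (\<xi>t v)^2) \<and> (\<integral>v. (\<xi>t v)^2 \<partial>N) = 1"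
    and rho_pos: "\<rho> > 0"
    and eig: "\<forall>\<omega>\<in>space M. eigenvalues_mult (\<chi> i j. lin_kernel (Xs \<omega> i) (Xs \<omega> j)) (\<gamma> \<omega>)"
    and f'_int: "\<forall>\<omega>\<in>space M. integrable N (\<lambda>v. (f' \<omega> (Xt v) - Yt v)^2)"
    and f'_risk: "\<forall>\<omega>\<in>space M. R (f' \<omega>) \<le> R (orbit_avg lam \<phi> (f \<omega>))"
  shows "ennreal ((norm \<theta>)^2 * (d * \<zeta>1 - \<zeta>2) * (d - (frobenius_norm \<Phi>)^2) / (d * (d + 2) * (d - 1))
                + (d - (frobenius_norm \<Phi>)^2) / (d * sqrt n + \<rho> / sqrt n)^2)
           \<le> (\<integral>\<^sup>+ \<omega>. ennreal (R (f \<omega>) - R (f' \<omega>)) \<partial>M)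
       \<and> (norm \<theta>)^2 * (d * \<zeta>1 - \<zeta>2) * (d - (frobenius_norm \<Phi>)^2) / (d * (d + 2) * (d - 1)) \<ge> 0
       \<and> (d - (frobenius_norm \<Phi>)^2) / (d * sqrt n + \<rho> / sqrt n)^2 \<ge> 0
       \<and> (norm \<theta>)^2 * (d * \<zeta>1 - \<zeta>2) * (d - (frobenius_norm \<Phi>)^2) / (d * (d + 2) * (d - 1))
           = (\<integral>\<omega>. (\<integral>x. (Lambda_ridge (Xs \<omega>) \<rho> fstar x
                              - orbit_avg lam \<phi> (Lambda_ridge (Xs \<omega>) \<rho> fstar) x)^2 \<partial>\<mu>) \<partial>M)
       \<and> Mk = d
       \<and> (d - (frobenius_norm \<Phi>)^2) / (d * sqrt n + \<rho> / sqrt n)^2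
           = (\<integral>x. (\<integral>y. (kperp lam \<phi> x y)^2 \<partial>\<mu>) \<partial>\<mu>) / (sqrt n * Mk + \<rho> / sqrt n)^2"
proof -
  interpret A: averaged_orth_rep gmul e ginv lam \<phi>
    by unfold_locales (rule group, rule rep)
  interpret M: prob_space M by (rule M)
  interpret S0: sphere_sample "sqrt d" \<mu> M Xs \<rho>
    by unfold_locales (use unif iid Xs_law rho_pos in auto)
  have F: "F = S0.sample_algebra" by (simp add: F_def S0.sample_algebra_def)
  interpret S: noisy_sphere_sample "sqrt d" \<mu> M Xs \<rho> \<xi>s
    by unfold_locales (use \<xi>s_mean \<xi>s_cov in \<open>auto simp: F\<close>)
  have d: "d > 1" and n: "n > 0" using d_gt1 by (simp_all add: d_def n_def)
  have sqrt_d: "(sqrt d)\<^sup>2 = d" using d by simp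
  let ?P = "A.coavg" and ?c = "S0.cross_moment"
  define p where "p = d - (frobenius_norm \<Phi>)\<^sup>2"
  have Phi: "\<Phi> = A.avg" by (simp add: \<Phi>_def A.avg_def)
  have p: "p = (\<Sum>k\<in>UNIV. (norm (?P $ k))\<^sup>2)"
    unfolding p_def Phi d_def A.frobenius_coavg[symmetric] by (rule frobenius_norm_square_rows)
  then have p_nonneg: "p \<ge> 0" by (simp add: sum_nonneg)
  have avg_theta: "A.avg *v \<theta> = \<theta>"
    by (rule A.avg_invariant_vector[of "sqrt d"]) (use inv d in \<open>auto simp: fstar_def\<close>)

  \<comment> \<open>Pointwise in \<omega> the spectral sums become traces of the ridge operator,
    which identifies the two zeta expectations with those in \<open>cross_moment\<close>.\<close>
  have eig': "eigenvalues_mult (gram (Xs \<omega>)) (\<gamma> \<omega>)" if "\<omega> \<in> space M" for \<omega>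
    using eig that by (simp add: gram_def lin_kernel_def)
  have "\<zeta>1 = (\<integral>\<omega>. trace (S0.hat \<omega> ** S0.hat \<omega>) \<partial>M)"
    unfolding \<zeta>1_def
    by (intro Bochner_Integration.integral_cong refl trace_ridge_op_square[OF rho_pos, symmetric] eig')
  moreover have "\<zeta>2 = (\<integral>\<omega>. (trace (S0.hat \<omega>))\<^sup>2 \<partial>M)"
    unfolding \<zeta>2_def
    by (intro Bochner_Integration.integral_cong refl) (simp add: trace_ridge_op[OF rho_pos eig'])
  ultimately have cross: "?c = (d * \<zeta>1 - \<zeta>2) / (d * (d + 2) * (d - 1))"
    by (simp add: S0.cross_moment_def d_def)
  have c_nonneg: "?c \<ge> 0" using d_gt1 by (rule S0.cross_moment_nonneg)
  define T1 where "T1 = (norm \<theta>)\<^sup>2 * (d * \<zeta>1 - \<zeta>2) * p / (d * (d + 2) * (d - 1))"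
  define T2 where "T2 = p / (d * sqrt n + \<rho> / sqrt n)\<^sup>2"
  have T1: "T1 = (norm \<theta>)\<^sup>2 * ?c * p" by (simp add: T1_def cross)
  have T1_nonneg: "T1 \<ge> 0" using c_nonneg p_nonneg by (simp add: T1)
  have T2_nonneg: "T2 \<ge> 0" using p_nonneg by (simp add: T2_def)
  \<comment> \<open>Clearing the square root of \<open>n\<close> brings the denominator into the
    form produced by the resolvent bound.\<close>
  have T2: "T2 = n * p / (n * d + \<rho>)\<^sup>2"
  proof -
    have "d * sqrt n + \<rho> / sqrt n = (n * d + \<rho>) / sqrt n" using n by (simp add: field_simps)
    then show ?thesis using n by (simp add: T2_def power_divide)
  qed

  have signal: "(\<integral>\<omega>. (?P $ k \<bullet> (S0.hat \<omega> *v \<theta>))\<^sup>2 \<partial>M) = (norm (?P $ k))\<^sup>2 * (norm \<theta>)\<^sup>2 * ?c" for k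
    by (rule S0.integral_inner_hat_square[OF d_gt1 A.coavg_row_orthogonal[OF avg_theta]])

  have bias: "(\<integral>\<omega>. (\<integral>x. (Lambda_ridge (Xs \<omega>) \<rho> fstar x
      - orbit_avg lam \<phi> (Lambda_ridge (Xs \<omega>) \<rho> fstar) x)\<^sup>2 \<partial>\<mu>) \<partial>M) = T1"
  proof -
    have "(\<integral>x. (Lambda_ridge (Xs \<omega>) \<rho> fstar x - orbit_avg lam \<phi> (Lambda_ridge (Xs \<omega>) \<rho> fstar) x)\<^sup>2 \<partial>\<mu>)
        = (\<Sum>k\<in>UNIV. (?P $ k \<bullet> (S0.hat \<omega> *v \<theta>))\<^sup>2)" for \<omega>
    proof -
      have "Lambda_ridge (Xs \<omega>) \<rho> fstar x - orbit_avg lam \<phi> (Lambda_ridge (Xs \<omega>) \<rho> fstar) x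
          = (?P *v (S0.hat \<omega> *v \<theta>)) \<bullet> x" for x
        unfolding fstar_def Lambda_ridge_linear[OF rho_pos] A.orbit_avg_linear
        by (simp add: A.coavg_def matrix_vector_mult_diff_rdistrib inner_diff_left)
      then show ?thesis
        using d by (simp add: S0.mu.integral_inner_square d_def[symmetric] norm_matrix_mult_square[symmetric])
    qed
    then have "(\<integral>\<omega>. (\<integral>x. (Lambda_ridge (Xs \<omega>) \<rho> fstar x
        - orbit_avg lam \<phi> (Lambda_ridge (Xs \<omega>) \<rho> fstar) x)\<^sup>2 \<partial>\<mu>) \<partial>M)
        = (\<Sum>k\<in>UNIV. (norm (?P $ k))\<^sup>2 * (norm \<theta>)\<^sup>2 * ?c)"
      by (simp add: Bochner_Integration.integral_sum S0.integrable_inner_hat_square signal)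
    also have "\<dots> = T1" by (simp add: T1 p sum_distrib_left sum_distrib_right mult_ac)
    finally show ?thesis .
  qed

  \<comment> \<open>For each sample, \<open>f'\<close> enters only through its risk bound, so the
    gap is at least the saving from averaging \<open>f\<close>. With squared radius \<open>d\<close>
    the sphere moment is exactly the squared norm, and Pythagoras gives the sum over the rows of the
    projection.\<close>
  have gap: "(\<Sum>k\<in>UNIV. (?P $ k \<bullet> S.weight \<omega> \<theta>)\<^sup>2) \<le> R (f \<omega>) - R (f' \<omega>)" if "\<omega> \<in> space M" for \<omega>
  proof -
    let ?w = "S.weight \<omega> \<theta>"
    have f: "f \<omega> = (\<lambda>x. ?w \<bullet> x)" by (rule ext) (simp only: f_def krr_linear_target)
    have risk: "R (\<lambda>x. w \<bullet> x) = (norm (w - \<theta>))\<^sup>2 + 1" for w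
      unfolding R_def using \<xi>t_mean \<xi>t_var d
      by (subst risk_linear_predictor[OF unif N Xt_law]) (simp_all add: d_def)
    have "R (f' \<omega>) \<le> R (orbit_avg lam \<phi> (f \<omega>))" using f'_risk that by blast
    then have "R (f' \<omega>) \<le> R (\<lambda>x. (A.avg *v ?w) \<bullet> x)"
      unfolding f A.orbit_avg_linear .
    then have "(norm (?w - \<theta>))\<^sup>2 - (norm (A.avg *v ?w - \<theta>))\<^sup>2 \<le> R (f \<omega>) - R (f' \<omega>)"
      unfolding f risk by linarith
    then show ?thesis
      using A.pythagoras_avg[OF avg_theta, of ?w] norm_matrix_mult_square[of ?P ?w] by linarith
  qed

  \<comment> \<open>Both terms split over the rows of the projection. The signal summand is an exact
    value; only the noise summand is estimated.\<close>
  have "T1 + T2 = (\<Sum>k\<in>UNIV. (norm (?P $ k))\<^sup>2 * (norm \<theta>)\<^sup>2 * ?c + n * (norm (?P $ k))\<^sup>2 / (n * d + \<rho>)\<^sup>2)"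
    by (simp add: T1 T2 p sum.distrib sum_distrib_left sum_distrib_right sum_divide_distrib mult_ac)
  also have "\<dots> \<le> (\<Sum>k\<in>UNIV. (\<integral>\<omega>. (?P $ k \<bullet> S.weight \<omega> \<theta>)\<^sup>2 \<partial>M))"
  proof (rule sum_mono)
    fix k
    have "n * (norm (?P $ k))\<^sup>2 / (n * d + \<rho>)\<^sup>2 \<le> (\<integral>\<omega>. (norm (S0.noise_coef \<omega> (?P $ k)))\<^sup>2 \<partial>M)"
      using S0.integral_norm_noise_coef_ge[of "?P $ k"] d
      unfolding sqrt_d n_def[symmetric] d_def[symmetric] by simp
    then show "(norm (?P $ k))\<^sup>2 * (norm \<theta>)\<^sup>2 * ?c + n * (norm (?P $ k))\<^sup>2 / (n * d + \<rho>)\<^sup>2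
        \<le> (\<integral>\<omega>. (?P $ k \<bullet> S.weight \<omega> \<theta>)\<^sup>2 \<partial>M)"
      unfolding S.integral_inner_weight_square signal by linarith
  qed
  also have "\<dots> = (\<integral>\<omega>. (\<Sum>k\<in>UNIV. (?P $ k \<bullet> S.weight \<omega> \<theta>)\<^sup>2) \<partial>M)"
    by (rule Bochner_Integration.integral_sum[symmetric]) (rule S.integrable_inner_weight_square)
  finally have "ennreal (T1 + T2) \<le> ennreal (\<integral>\<omega>. (\<Sum>k\<in>UNIV. (?P $ k \<bullet> S.weight \<omega> \<theta>)\<^sup>2) \<partial>M)"
    by (rule ennreal_leI)
  also have "\<dots> = (\<integral>\<^sup>+ \<omega>. ennreal (\<Sum>k\<in>UNIV. (?P $ k \<bullet> S.weight \<omega> \<theta>)\<^sup>2) \<partial>M)"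
    by (rule nn_integral_eq_integral[symmetric])
       (intro Bochner_Integration.integrable_sum S.integrable_inner_weight_square, simp add: sum_nonneg)
  \<comment> \<open>The nonnegative integral is monotone for arbitrary integrands, so the pointwise
    gap transfers directly. That gap also makes the difference of risks nonnegative, so
    \<open>ennreal\<close> truncates nothing.\<close>
  also have "\<dots> \<le> (\<integral>\<^sup>+ \<omega>. ennreal (R (f \<omega>) - R (f' \<omega>)) \<partial>M)"
    by (intro nn_integral_mono ennreal_leI gap)
  finally have main: "ennreal (T1 + T2) \<le> (\<integral>\<^sup>+ \<omega>. ennreal (R (f \<omega>) - R (f' \<omega>)) \<partial>M)" .

  have "lin_kernel x x = d" if "x \<in> sphere 0 (sqrt d)" for x :: "real^'n"
  proof -
    have "norm x = sqrt d" using that by simp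
    then show ?thesis by (simp only: lin_kernel_def power2_norm_eq_inner[symmetric] sqrt_d)
  qed
  moreover have "sphere (0 :: real^'n) (sqrt d) \<noteq> {}" using d by simp
  ultimately have "(\<lambda>x::real^'n. lin_kernel x x) ` sphere 0 (sqrt d) = {d}" by fastforce
  then have Mk: "Mk = d" by (simp add: Mk_def d_def)

  \<comment> \<open>With squared radius \<open>d\<close>, integrating the square of
    \<open>(?P *v x) \<bullet> y\<close> over \<open>y\<close> gives the squared norm of
    \<open>?P *v x\<close>; integrating that over \<open>x\<close> gives the sum of the squared row
    norms.\<close>
  have "(\<integral>x. (\<integral>y. (kperp lam \<phi> x y)\<^sup>2 \<partial>\<mu>) \<partial>\<mu>) = (\<integral>x. (\<Sum>k\<in>UNIV. (?P $ k \<bullet> x)\<^sup>2) \<partial>\<mu>)"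
    using d by (simp add: A.kperp_eq S0.mu.integral_inner_square d_def[symmetric] norm_matrix_mult_square)
  also have "\<dots> = p"
    using d by (simp add: Bochner_Integration.integral_sum S0.mu.integrable_inner_square
        S0.mu.integral_inner_square d_def[symmetric] p)
  finally have kperp: "(\<integral>x. (\<integral>y. (kperp lam \<phi> x y)\<^sup>2 \<partial>\<mu>) \<partial>\<mu>) = p" .
  have "T2 = (\<integral>x. (\<integral>y. (kperp lam \<phi> x y)\<^sup>2 \<partial>\<mu>) \<partial>\<mu>) / (sqrt n * Mk + \<rho> / sqrt n)\<^sup>2"
    unfolding kperp Mk T2_def by (simp add: mult.commute)
  with main T1_nonneg T2_nonneg bias Mk show ?thesis
    unfolding T1_def T2_def p_def by auto
qed

end
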